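(* Let $\mathcal M(\mathfrak s)$ be an $\mathfrak m$-critical closed RW universe with nonconstant scale function $\mathfrak s$, internal parameters $\mathcal H\neq0$ and $\mathfrak a$, and cosmological constant $\Lambda$. Then its conformal scale function $\mathrm S$ is given by $$\mathrm S(\tau)=\frac{3\mathcal H}{12\,\mathrm Q(\tau)-1},$$ where $\mathrm Q$ is a real form of the Weierstrass $\wp$-function with invariants $$g_2=\frac1{12},\qquad g_3=\frac1{48}\left(\mathfrak a\mathcal H^2-\frac29\right).$$ The conformal energy density and the conformal pressure are given by $$\widetilde{\mathfrak m}=\frac1{8\pi}\left(\frac{(1-12\mathrm Q)^2(5+12\mathrm Q)}{9\mathcal H^2}-\mathfrak a-\Lambda\right),\qquad \widetilde{\mathfrak p}=\frac1{4\pi}\left(\frac{\mathfrak a+\Lambda}{2}-\frac{(12\mathrm Q-1)^2}{9\mathcal H^2}\right).$$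
   Context: Let $g$ be the standard Riemannian metric of the unit sphere $\mathbb S^3\subset\mathbb R^4$. A closed RW spacetime (universe) is $\mathcal M(\mathfrak s)=\mathrm I_{\mathfrak s}\times\mathbb S^3$, with $\mathrm I_{\mathfrak s}\subset\mathbb R$ an open interval, $\mathfrak s$ a nonnegative scale function on $\mathrm I_{\mathfrak s}$ (smooth where positive), the (possibly degenerate) Lorentz metric $\ell_{\mathfrak s}=-dt^2+\mathfrak s^2(t)g$, a cosmological constant $\Lambda\in\mathbb R$ and stress-energy tensor $\mathrm T=\mathfrak m\,dt^2+\mathfrak p\,\mathfrak s^2g$, satisfying the Einstein equation, which is equivalent to $$\mathfrak m=\frac{3}{8\pi}\left(\frac{\dot{\mathfrak s}^2}{\mathfrak s^2}+\frac1{\mathfrak s^2}-\frac{\Lambda}{3}\right),\qquad \mathfrak p=-\frac1{4\pi\mathfrak s}\left(\ddot{\mathfrak s}+\frac1{2\mathfrak s}(\dot{\mathfrak s}^2+1)-\frac\Lambda2\mathfrak s\right)$$ (dot $=d/dt$; equations are understood where $\mathfrak s>0$). The spacetime is $\mathfrak m$-critical if $\mathfrak s$ is a critical point of $\int_{[t_0,t_1]\times\mathbb S^3}\mathfrak m\,dV_{\ell_{\mathfrak s}}$ with respect to volume-preserving variations (variations keeping $\int_{t_0}^{t_1}\mathfrak s^3dt$ constant); for nonconstant $\mathfrak s$ this is expressed by the equation $\mathfrak s\left(\dot{\mathfrak s}^2+\frac{\mathfrak a}{3}\mathfrak s^2-1\right)=\mathcal H$ with constants $\mathfrak a,\mathcal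 H$, called the internal parameters. The scale function may vanish at some points, but it is assumed that the conformal time $\tau_{\mathfrak s}(t)=\int_{t_0}^t\frac{du}{\mathfrak s(u)}$ is a continuous, strictly increasing function on $\mathrm I_{\mathfrak s}$ and that $\tau_{\mathfrak s}^{-1}$ is differentiable on the open interval $\mathrm J_{\mathfrak s}=\tau_{\mathfrak s}(\mathrm I_{\mathfrak s})$. The conformal scale function is the nonnegative differentiable function $\mathrm S=\mathfrak s\circ\tau_{\mathfrak s}^{-1}:\mathrm J_{\mathfrak s}\to\mathbb R$; the conformal energy density and conformal pressure are $\widetilde{\mathfrak m}=\mathfrak m\circ\tau_{\mathfrak s}^{-1}$ and $\widetilde{\mathfrak p}=\mathfrak p\circ\tau_{\mathfrak s}^{-1}$ (with values in $\mathbb R\cup\{+\infty\}$ and $\mathbb R\cup\{\pm\infty\}$ respectively). A real form of the Weierstrass elliptic function $\wp(z;g_2,g_3)$ with real invariants $g_2,g_3$ is a nonconstant function $\mathrm Q:\mathbb R\to\mathbb R\cup\{+\infty\}$ (real analytic away from the isolated poles where it takes the value $+\infty$) such that $\mathrm Q'^2=4\mathrm Q^3-g_2\mathrm Q-g_3$. At a pole of $\mathrm Q$ the formula for $\mathrm S$ is read as $\mathrm S=0$. *)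

theory Defs
  imports "HOL-Analysis.Analysis"
begin

section \<open>Closed RW universes\<close>

text \<open>
  The spacetime \<open>I \<times> S\<^sup>3\<close> with metric \<open>- dt\<^sup>2 + s(t)\<^sup>2 g\<close> is represented by the interval \<open>I\<close> and the
  scale function \<open>s\<close>, which determine it. Only the values of \<open>s\<close> on \<open>I\<close> matter.
\<close>

text \<open>The Einstein equation determines energy density and pressure wherever \<open>s > 0\<close>.\<close>

definition energy_density :: "real \<Rightarrow> (real \<Rightarrow> real) \<Rightarrow> real \<Rightarrow> real" where
  "energy_density \<Lambda> s t =
     3 / (8 * pi) * ((deriv s t)\<^sup>2 / (s t)\<^sup>2 + 1 / (s t)\<^sup>2 - \<Lambda> / 3)"

definition pressure :: "real \<Rightarrow> (real \<Rightarrow> real) \<Rightarrow> real \<Rightarrow> real" where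
  "pressure \<Lambda> s t =
     - (1 / (4 * pi * s t)) *
       (deriv (deriv s) t + 1 / (2 * s t) * ((deriv s t)\<^sup>2 + 1) - \<Lambda> / 2 * s t)"

text \<open>
  At a zero of \<open>s\<close> the energy density and the pressure are extended by their limits in the
  extended reals, taken through times at which \<open>s > 0\<close>.
\<close>

definition extend_to_zeros ::
    "real set \<Rightarrow> (real \<Rightarrow> real) \<Rightarrow> (real \<Rightarrow> real) \<Rightarrow> real \<Rightarrow> ereal" where
  "extend_to_zeros I s f t =
     (if 0 < s t then ereal (f t)
      else Lim (at t within {u \<in> I. 0 < s u}) (\<lambda>u. ereal (f u)))"

definition conformal_time :: "(real \<Rightarrow> real) \<Rightarrow> real \<Rightarrow> real \<Rightarrow> real" where
  "conformal_time s t0 t = (LBINT u = ereal t0..ereal t. 1 / s u)"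

text \<open>
  In \<open>closed_RW\<close>, iterated derivatives at a point where \<open>s > 0\<close> depend only on \<open>s\<close> near that
  point, by continuity of \<open>s\<close> and openness of \<open>I\<close>. Continuity of \<open>s\<close> on all of \<open>I\<close> is weaker than
  differentiability of the conformal scale function \<open>S\<close>, as \<open>s = S \<circ> \<tau>\<close> for the conformal time \<open>\<tau>\<close>.

  Finiteness of the conformal time is expressed with \<open>ennreal\<close>-valued integrals, where the inverse of
  \<open>0\<close> is \<open>\<infinity>\<close>. In particular the zeros of \<open>s\<close> form a null set, so that the convention \<open>1 / 0 = 0\<close> for
  reals does not influence \<open>conformal_time\<close>.
\<close>

definition closed_RW :: "real set \<Rightarrow> (real \<Rightarrow> real) \<Rightarrow> real \<Rightarrow> bool" where
  "closed_RW I s t0 \<longleftrightarrow>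
     open I \<and> is_interval I \<and> t0 \<in> I \<and>
     (\<forall>t\<in>I. 0 \<le> s t) \<and> continuous_on I s \<and>
     (\<forall>n. \<forall>t\<in>I. 0 < s t \<longrightarrow> ((deriv ^^ n) s) differentiable (at t)) \<and>
     (\<forall>a\<in>I. \<forall>b\<in>I. (\<integral>\<^sup>+u\<in>{a..b}. inverse (ennreal (s u)) \<partial>lborel) < \<infinity>) \<and>
     continuous_on I (conformal_time s t0) \<and>
     strict_mono_on I (conformal_time s t0) \<and>
     (inv_into I (conformal_time s t0)) differentiable_on (conformal_time s t0 ` I)"

definition conformal_interval :: "real set \<Rightarrow> (real \<Rightarrow> real) \<Rightarrow> real \<Rightarrow> real set" where
  "conformal_interval I s t0 = conformal_time s t0 ` I"

definition conformal_scale :: "real set \<Rightarrow> (real \<Rightarrow> real) \<Rightarrow> real \<Rightarrow> real \<Rightarrow> real" where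
  "conformal_scale I s t0 = s \<circ> inv_into I (conformal_time s t0)"

definition conformal_energy_density ::
    "real \<Rightarrow> real set \<Rightarrow> (real \<Rightarrow> real) \<Rightarrow> real \<Rightarrow> real \<Rightarrow> ereal" where
  "conformal_energy_density \<Lambda> I s t0 =
     extend_to_zeros I s (energy_density \<Lambda> s) \<circ> inv_into I (conformal_time s t0)"

definition conformal_pressure ::
    "real \<Rightarrow> real set \<Rightarrow> (real \<Rightarrow> real) \<Rightarrow> real \<Rightarrow> real \<Rightarrow> ereal" where
  "conformal_pressure \<Lambda> I s t0 =
     extend_to_zeros I s (pressure \<Lambda> s) \<circ> inv_into I (conformal_time s t0)"


section \<open>Critical universes\<close>

text \<open>
  \<open>mixed_partial w f\<close> is an iterated partial derivative of \<open>f\<close>; \<open>True\<close> stands for the first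
  variable. \<open>smooth_on_plane U f\<close> says that \<open>f\<close> is \<open>C\<^sup>\<infinity>\<close> on the open set \<open>U\<close>.
\<close>

primrec mixed_partial :: "bool list \<Rightarrow> (real \<times> real \<Rightarrow> real) \<Rightarrow> real \<times> real \<Rightarrow> real" where
  "mixed_partial [] f = f"
| "mixed_partial (b # w) f =
     (\<lambda>(x, y). if b then deriv (\<lambda>u. mixed_partial w f (u, y)) x
               else deriv (\<lambda>u. mixed_partial w f (x, u)) y)"

definition smooth_on_plane :: "(real \<times> real) set \<Rightarrow> (real \<times> real \<Rightarrow> real) \<Rightarrow> bool" where
  "smooth_on_plane U f \<longleftrightarrow>
     (\<forall>w. continuous_on U (mixed_partial w f) \<and>
          (\<forall>(x, y)\<in>U. (\<lambda>u. mixed_partial w f (u, y)) differentiable (at x) \<and>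
                       (\<lambda>u. mixed_partial w f (x, u)) differentiable (at y)))"

text \<open>
  The volume form of the metric is \<open>s(t)\<^sup>3 dt\<close> times the one of the unit sphere \<open>S\<^sup>3\<close>, whose
  total volume is \<open>2 \<pi>\<^sup>2\<close>.
\<close>

definition total_energy :: "real \<Rightarrow> (real \<Rightarrow> real) \<Rightarrow> real \<Rightarrow> real \<Rightarrow> real" where
  "total_energy \<Lambda> s a b =
     2 * pi\<^sup>2 * (LBINT t = ereal a..ereal b. energy_density \<Lambda> s t * (s t) ^ 3)"

text \<open>
  A volume-preserving variation of \<open>s\<close> on \<open>[a, b]\<close> is a smooth one-parameter family \<open>\<sigma> \<epsilon>\<close> of positive
  scale functions with \<open>\<sigma> 0 = s\<close>, unchanged near the end points \<open>a\<close> and \<open>b\<close>.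
\<close>

definition volume_preserving_variation ::
    "(real \<Rightarrow> real) \<Rightarrow> real \<Rightarrow> real \<Rightarrow> (real \<Rightarrow> real \<Rightarrow> real) \<Rightarrow> bool" where
  "volume_preserving_variation s a b \<sigma> \<longleftrightarrow>
     (\<forall>t. \<sigma> 0 t = s t) \<and>
     (\<exists>c d. a < c \<and> d < b \<and> (\<forall>\<epsilon> t. t \<notin> {c..d} \<longrightarrow> \<sigma> \<epsilon> t = s t)) \<and>
     (\<exists>\<delta>>0.
        smooth_on_plane ({-\<delta><..<\<delta>} \<times> {a<..<b}) (\<lambda>(\<epsilon>, t). \<sigma> \<epsilon> t) \<and>
        (\<forall>\<epsilon>\<in>{-\<delta><..<\<delta>}. \<forall>t\<in>{a..b}. 0 < \<sigma> \<epsilon> t) \<and>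
        (\<forall>\<epsilon>\<in>{-\<delta><..<\<delta>}.
           (LBINT t = ereal a..ereal b. (\<sigma> \<epsilon> t) ^ 3) = (LBINT t = ereal a..ereal b. (s t) ^ 3)))"

definition m_critical :: "real \<Rightarrow> real set \<Rightarrow> (real \<Rightarrow> real) \<Rightarrow> bool" where
  "m_critical \<Lambda> I s \<longleftrightarrow>
     (\<forall>a b \<sigma>. a < b \<longrightarrow> {a..b} \<subseteq> {t \<in> I. 0 < s t} \<longrightarrow> volume_preserving_variation s a b \<sigma> \<longrightarrow>
        ((\<lambda>\<epsilon>. total_energy \<Lambda> (\<sigma> \<epsilon>) a b) has_real_derivative 0) (at 0))"

text \<open>
  For nonconstant \<open>s\<close>, the following equation is the first integral of the Euler-Lagrange equation of
  the variational problem above, with \<open>\<aa>\<close> coming from the Lagrange multiplier of the volume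
  constraint. The constants are the same on all components of the set where \<open>s > 0\<close>.
\<close>

definition internal_parameters ::
    "real set \<Rightarrow> (real \<Rightarrow> real) \<Rightarrow> real \<Rightarrow> real \<Rightarrow> bool" where
  "internal_parameters I s H \<aa> \<longleftrightarrow>
     (\<forall>t\<in>I. 0 < s t \<longrightarrow> s t * ((deriv s t)\<^sup>2 + \<aa> / 3 * (s t)\<^sup>2 - 1) = H)"


section \<open>Real forms of the Weierstrass elliptic function\<close>

definition real_analytic_at :: "(real \<Rightarrow> real) \<Rightarrow> real \<Rightarrow> bool" where
  "real_analytic_at f x \<longleftrightarrow> (\<exists>F. (\<lambda>h. f (x + h)) has_fps_expansion F)"

definition weierstrass_real_form :: "real \<Rightarrow> real \<Rightarrow> (real \<Rightarrow> ereal) \<Rightarrow> bool" where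
  "weierstrass_real_form g2 g3 Q \<longleftrightarrow>
     \<not> Q constant_on UNIV \<and>
     (\<forall>x. Q x \<noteq> -\<infinity>) \<and>
     (\<forall>x. Q x = \<infinity> \<longrightarrow> (\<forall>\<^sub>F y in at x. Q y \<noteq> \<infinity>) \<and> (Q \<longlongrightarrow> \<infinity>) (at x)) \<and>
     (\<forall>x. Q x \<noteq> \<infinity> \<longrightarrow>
        real_analytic_at (\<lambda>y. real_of_ereal (Q y)) x \<and>
        (deriv (\<lambda>y. real_of_ereal (Q y)) x)\<^sup>2 =
          4 * real_of_ereal (Q x) ^ 3 - g2 * real_of_ereal (Q x) - g3)"

end

theory Submission
  imports Defs
begin

text \<open>
  With \<open>Q = 1/12 + H / (4 S)\<close> the first integral becomes the Weierstrass equation along the conformal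
  time. The function \<open>u = 1 / (Q - 1/12 + b)\<close> is zero at the poles of \<open>Q\<close>, and for \<open>b\<close> large it
  takes values in \<open>[0, 1)\<close> and satisfies \<open>u'\<^sup>2 = R(u)\<close> and \<open>u'' = R'(u) / 2\<close> with a quartic polynomial \<open>R\<close>.
  Power series solve this regular equation on intervals of uniform length, so each solution extends
  analytically to the whole real line, and \<open>Q\<close> is recovered from it.

  A first-order equation alone would allow \<open>s\<close> to be constant for a while. Since \<open>s\<close> is smooth where
  positive and not constant, the second-order equation holds even at critical points of \<open>s\<close>. The
  zeros of \<open>s\<close> are isolated, and \<open>u\<close> solves its equation there as well.
\<close>

section \<open>Power series solutions\<close>

text \<open>The form Q must be analytic on the whole line, whereas the universe fills only an
  interval. So Q is built by solving a differential equation, and the universe supplies just the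
  initial data. Put w = Q - 1/12 = H / (4 S). In conformal time w'^2 = 4 w^3 + w^2 - g with g =
  \<open>\<aa> * H\<^sup>2 / 48\<close>; the shift by 1/12 removes the quadratic term and yields g2
  = 1/12 and g3 = g - 1/216. The cubic in w is negative for w \<le> -1 - |g|, a range that no real
  solution can enter. Hence b = 2 + |g| gives w + b > 1, which is why u = 1 / (w + b) stays in [0,
  1), poles included. This confinement bounds u and u' independently of the starting point, so step
  lengths and Lipschitz constants are uniform and nothing blows up. The second-order equation
  carries existence and uniqueness because sqrt R fails to be Lipschitz at simple zeros of R, and u
  = 0, the value at every pole, is such a zero.\<close>

fun cubic_ode_coeff :: "real \<Rightarrow> real \<Rightarrow> real \<Rightarrow> real \<Rightarrow> real \<Rightarrow> real \<Rightarrow> nat \<Rightarrow> real" where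
  "cubic_ode_coeff c0 c1 c2 c3 y v 0 = y"
| "cubic_ode_coeff c0 c1 c2 c3 y v (Suc 0) = v"
| "cubic_ode_coeff c0 c1 c2 c3 y v (Suc (Suc n)) =
     ((if n = 0 then c0 else 0) + c1 * cubic_ode_coeff c0 c1 c2 c3 y v n
      + c2 * (\<Sum>i=0..n. cubic_ode_coeff c0 c1 c2 c3 y v i * cubic_ode_coeff c0 c1 c2 c3 y v (n - i))
      + c3 * (\<Sum>i=0..n. (\<Sum>j=0..i. cubic_ode_coeff c0 c1 c2 c3 y v j * cubic_ode_coeff c0 c1 c2 c3 y v (i - j))
                 * cubic_ode_coeff c0 c1 c2 c3 y v (n - i)))
     / ((real n + 1) * (real n + 2))"

text \<open>By induction every product in the cubic Cauchy sum is at most K^m, and the denominator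
  (m + 1) (m + 2) outweighs the number of these products. The sum of the |ci| pays for the two extra
  powers of K. So K alone controls the radius of convergence.\<close>

lemma cubic_ode_coeff_bound:
  assumes "\<bar>y\<bar> \<le> 1" "\<bar>v\<bar> \<le> K" "1 \<le> K" "\<bar>c0\<bar> + \<bar>c1\<bar> + \<bar>c2\<bar> + \<bar>c3\<bar> \<le> K\<^sup>2"
  shows "\<bar>cubic_ode_coeff c0 c1 c2 c3 y v n\<bar> \<le> K ^ n"
proof (induction n rule: less_induct)
  case (less n)
  let ?a = "cubic_ode_coeff c0 c1 c2 c3 y v"
  consider "n = 0" | "n = 1" | m where "n = Suc (Suc m)"
    by (metis One_nat_def not0_implies_Suc)
  then show ?case
  proof cases
    case 3
    let ?N = "(real m + 1) * (real m + 2)"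
    have IH: "\<bar>?a i\<bar> \<le> K ^ i" if "i \<le> m" for i
      using less.IH[of i] that 3 by simp
    have prod2: "\<bar>?a j * ?a (i - j)\<bar> \<le> K ^ i" if "j \<le> i" "i \<le> m" for i j
    proof -
      have "\<bar>?a j * ?a (i - j)\<bar> \<le> K ^ j * K ^ (i - j)"
        unfolding abs_mult using IH[of j] IH[of "i - j"] that by (intro mult_mono) auto
      then show ?thesis using that by (simp flip: power_add)
    qed
    have sum2: "\<bar>\<Sum>j=0..i. ?a j * ?a (i - j)\<bar> \<le> (real i + 1) * K ^ i" if "i \<le> m" for i
    proof -
      have "\<bar>\<Sum>j=0..i. ?a j * ?a (i - j)\<bar> \<le> (\<Sum>j=0..i. K ^ i)"
        using prod2 that by (intro order_trans[OF sum_abs] sum_mono) auto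
      then show ?thesis by (simp add: algebra_simps)
    qed
    have sum3: "\<bar>\<Sum>i=0..m. (\<Sum>j=0..i. ?a j * ?a (i - j)) * ?a (m - i)\<bar> \<le> ?N * K ^ m"
    proof -
      have "\<bar>(\<Sum>j=0..i. ?a j * ?a (i - j)) * ?a (m - i)\<bar> \<le> (real m + 1) * K ^ m" if "i \<le> m" for i
      proof -
        have "\<bar>(\<Sum>j=0..i. ?a j * ?a (i - j)) * ?a (m - i)\<bar> \<le> ((real i + 1) * K ^ i) * K ^ (m - i)"
          unfolding abs_mult using sum2[of i] IH[of "m - i"] that assms(3) by (intro mult_mono) auto
        also have "\<dots> = (real i + 1) * K ^ m"
          using that by (simp add: mult.assoc flip: power_add)
        also have "\<dots> \<le> (real m + 1) * K ^ m"
          using that assms(3) by (intro mult_right_mono) auto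
        finally show ?thesis .
      qed
      then have "\<bar>\<Sum>i=0..m. (\<Sum>j=0..i. ?a j * ?a (i - j)) * ?a (m - i)\<bar> \<le> (\<Sum>i=0..m. (real m + 1) * K ^ m)"
        by (intro order_trans[OF sum_abs] sum_mono) auto
      also have "\<dots> = (real m + 1) * (real m + 1) * K ^ m" by (simp add: algebra_simps)
      also have "\<dots> \<le> ?N * K ^ m"
        using assms(3) by (intro mult_right_mono mult_left_mono) auto
      finally show ?thesis .
    qed
    have N1: "1 \<le> ?N" "real m + 1 \<le> ?N" by (auto simp: algebra_simps)
    have Km: "1 \<le> K ^ m" using assms(3) by simp
    have NKm: "1 \<le> ?N * K ^ m" "K ^ m \<le> ?N * K ^ m" "(real m + 1) * K ^ m \<le> ?N * K ^ m"
      using mult_mono[OF N1(1) Km] mult_right_mono[OF N1(1), of "K ^ m"]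
        mult_right_mono[OF N1(2), of "K ^ m"] Km by auto
    have "\<bar>?a n * ?N\<bar> = \<bar>(if m = 0 then c0 else 0) + c1 * ?a m
        + c2 * (\<Sum>i=0..m. ?a i * ?a (m - i))
        + c3 * (\<Sum>i=0..m. (\<Sum>j=0..i. ?a j * ?a (i - j)) * ?a (m - i))\<bar>"
      using 3 by (simp add: add_nonneg_eq_0_iff)
    also have "\<dots> \<le> \<bar>c0\<bar> * (?N * K ^ m) + \<bar>c1\<bar> * (?N * K ^ m) + \<bar>c2\<bar> * (?N * K ^ m) + \<bar>c3\<bar> * (?N * K ^ m)"
    proof -
      have "\<bar>if m = 0 then c0 else 0\<bar> \<le> \<bar>c0\<bar> * (?N * K ^ m)"
        using mult_left_mono[OF NKm(1), of "\<bar>c0\<bar>"] by auto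
      moreover have "\<bar>c1 * ?a m\<bar> \<le> \<bar>c1\<bar> * (?N * K ^ m)"
        unfolding abs_mult using IH[of m] NKm by (intro mult_left_mono) auto
      moreover have "\<bar>c2 * (\<Sum>i=0..m. ?a i * ?a (m - i))\<bar> \<le> \<bar>c2\<bar> * (?N * K ^ m)"
        unfolding abs_mult[of c2] using order_trans[OF sum2[of m] NKm(3)] by (intro mult_left_mono) auto
      moreover have "\<bar>c3 * (\<Sum>i=0..m. (\<Sum>j=0..i. ?a j * ?a (i - j)) * ?a (m - i))\<bar> \<le> \<bar>c3\<bar> * (?N * K ^ m)"
        unfolding abs_mult[of c3] using sum3 by (intro mult_left_mono) auto
      moreover have "\<bar>p + q + r + s\<bar> \<le> P + Q + R + S"
        if "\<bar>p\<bar> \<le> P" "\<bar>q\<bar> \<le> Q" "\<bar>r\<bar> \<le> R" "\<bar>s\<bar> \<le> S" for p q r s P Q R S :: real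
        using that by linarith
      ultimately show ?thesis by blast
    qed
    also have "\<dots> = (\<bar>c0\<bar> + \<bar>c1\<bar> + \<bar>c2\<bar> + \<bar>c3\<bar>) * (?N * K ^ m)" by (simp add: algebra_simps)
    also have "\<dots> \<le> K\<^sup>2 * (?N * K ^ m)"
      using assms(3,4) by (intro mult_right_mono) auto
    finally have "\<bar>?a n\<bar> * ?N \<le> K ^ n * ?N"
      using 3 by (simp add: abs_mult power2_eq_square mult_ac)
    then show ?thesis
      using N1 by (simp add: mult_le_cancel_right)
  qed (use assms in auto)
qed

lemma cubic_ode_local_solution:
  fixes c0 c1 c2 c3 x0 y0 v0 K :: real
  assumes "\<bar>y0\<bar> \<le> 1" "\<bar>v0\<bar> \<le> K" "1 \<le> K" "\<bar>c0\<bar> + \<bar>c1\<bar> + \<bar>c2\<bar> + \<bar>c3\<bar> \<le> K\<^sup>2"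
  obtains y v where "y x0 = y0" "v x0 = v0" "real_analytic_at y x0"
    "\<And>x. \<bar>x - x0\<bar> < 1 / K \<Longrightarrow> (y has_real_derivative v x) (at x)"
    "\<And>x. \<bar>x - x0\<bar> < 1 / K \<Longrightarrow>
      (v has_real_derivative c0 + c1 * y x + c2 * y x ^ 2 + c3 * y x ^ 3) (at x)"
proof -
  let ?a = "cubic_ode_coeff c0 c1 c2 c3 y0 v0"
  define Y where "Y = Abs_fps ?a"
  have nth: "fps_nth Y n = ?a n" for n by (simp add: Y_def)
  have rad: "fps_conv_radius Y \<ge> ereal (1 / K)"
    unfolding fps_conv_radius_def
  proof (rule conv_radius_geI_ex')
    fix r :: real assume r: "0 < r" "ereal r < ereal (1 / K)"
    then have rK: "K * r < 1" using assms(3) by (simp add: field_simps)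
    have "norm (fps_nth Y n * of_real r ^ n) \<le> (K * r) ^ n" for n
      using cubic_ode_coeff_bound[OF assms, of n] r
      by (simp add: nth abs_mult power_mult_distrib mult_right_mono)
    then show "summable (\<lambda>n. fps_nth Y n * of_real r ^ n)"
      using rK r assms(3)
      by (intro summable_comparison_test'[OF summable_geometric[of "K * r"], of 0]) auto
  qed
  have rad': "norm h < fps_conv_radius Y" if "\<bar>h\<bar> < 1 / K" for h
    using that rad by (metis less_ereal.simps(1) less_le_trans real_norm_def)
  have rad'': "norm h < fps_conv_radius (fps_deriv Y)" if "\<bar>h\<bar> < 1 / K" for h
    using rad'[OF that] fps_conv_radius_deriv[of Y] by (rule less_le_trans)
  have ode: "fps_deriv (fps_deriv Y) =
      fps_const c0 + fps_const c1 * Y + fps_const c2 * Y ^ 2 + fps_const c3 * Y ^ 3"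
  proof (rule fps_ext)
    fix n
    have "fps_nth (fps_deriv (fps_deriv Y)) n = (real n + 1) * (real n + 2) * ?a (Suc (Suc n))"
      by (simp add: nth algebra_simps del: cubic_ode_coeff.simps)
    also have "\<dots> = (if n = 0 then c0 else 0) + c1 * ?a n
        + c2 * (\<Sum>i=0..n. ?a i * ?a (n - i))
        + c3 * (\<Sum>i=0..n. (\<Sum>j=0..i. ?a j * ?a (i - j)) * ?a (n - i))"
      by (simp add: add_nonneg_eq_0_iff)
    also have "\<dots> = fps_nth (fps_const c0 + fps_const c1 * Y + fps_const c2 * Y ^ 2 + fps_const c3 * Y ^ 3) n"
      by (simp add: power2_eq_square power3_eq_cube fps_mult_nth[of Y Y] fps_mult_nth[of "Y * Y" Y] nth
          del: cubic_ode_coeff.simps)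
    finally show "fps_nth (fps_deriv (fps_deriv Y)) n =
      fps_nth (fps_const c0 + fps_const c1 * Y + fps_const c2 * Y ^ 2 + fps_const c3 * Y ^ 3) n" .
  qed
  define y where "y = (\<lambda>x. eval_fps Y (x - x0))"
  define v where "v = (\<lambda>x. eval_fps (fps_deriv Y) (x - x0))"
  have evalode: "eval_fps (fps_deriv (fps_deriv Y)) h =
      c0 + c1 * eval_fps Y h + c2 * eval_fps Y h ^ 2 + c3 * eval_fps Y h ^ 3"
    if h: "\<bar>h\<bar> < 1 / K" for h
  proof -
    note r = rad'[OF h]
    have pw: "norm h < fps_conv_radius (Y ^ n)" for n
      using r fps_conv_radius_power[of Y n] by (rule less_le_trans)
    have ct: "norm h < fps_conv_radius (fps_const c * Y ^ n)" for c n
      using pw[of n] fps_conv_radius_mult[of "fps_const c" "Y ^ n"] by (auto intro: less_le_trans)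
    have ct1: "norm h < fps_conv_radius (fps_const c * Y)" for c
      using ct[of c 1] by simp
    have s1: "norm h < fps_conv_radius (fps_const c0 + fps_const c1 * Y)"
      using ct1[of c1] fps_conv_radius_add[of "fps_const c0" "fps_const c1 * Y"] by (auto intro: less_le_trans)
    have s2: "norm h < fps_conv_radius (fps_const c0 + fps_const c1 * Y + fps_const c2 * Y ^ 2)"
      using s1 ct[of c2 2] fps_conv_radius_add[of "fps_const c0 + fps_const c1 * Y" "fps_const c2 * Y ^ 2"]
      by (meson less_le_trans min_less_iff_conj)
    show ?thesis
      unfolding ode
      using r pw ct ct1 s1 s2 by (simp add: eval_fps_add eval_fps_mult eval_fps_power)
  qed
  have Kpos: "0 < 1 / K" using assms(3) by simp
  show ?thesis
  proof
    show "y x0 = y0" "v x0 = v0" by (simp_all add: y_def v_def eval_fps_at_0 nth)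
    have "0 < fps_conv_radius Y" using rad'[of 0] Kpos by (simp add: zero_ereal_def)
    then show "real_analytic_at y x0"
      unfolding real_analytic_at_def y_def by (intro exI[of _ Y]) (simp add: eval_fps_has_fps_expansion)
  next
    fix x assume x: "\<bar>x - x0\<bar> < 1 / K"
    show "(y has_real_derivative v x) (at x)"
      unfolding y_def v_def
      using has_field_derivative_eval_fps[OF rad'[OF x], of UNIV]
      by (simp flip: DERIV_shift[of "eval_fps Y" _ x "- x0", simplified])
    show "(v has_real_derivative c0 + c1 * y x + c2 * y x ^ 2 + c3 * y x ^ 3) (at x)"
      unfolding y_def v_def evalode[OF x, symmetric]
      using has_field_derivative_eval_fps[OF rad''[OF x], of UNIV]
      by (simp flip: DERIV_shift[of "eval_fps (fps_deriv Y)" _ x "- x0", simplified])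
  qed
qed

section \<open>Solutions of the quartic equation\<close>

text \<open>This is y^4 P(1/y - b) for P(w) = 4 w^3 + w^2 - g, with the denominators cleared so that
  it also makes sense at y = 0, where Q has a pole.\<close>

definition quartic :: "real \<Rightarrow> real \<Rightarrow> real \<Rightarrow> real" where
  "quartic b g y = 4 * y * (1 - b * y) ^ 3 + y\<^sup>2 * (1 - b * y)\<^sup>2 - g * y ^ 4"

definition half_quartic_deriv :: "real \<Rightarrow> real \<Rightarrow> real \<Rightarrow> real" where
  "half_quartic_deriv b g y =
     2 + (1 - 12 * b) * y + (18 * b\<^sup>2 - 3 * b) * y ^ 2 + 2 * (b\<^sup>2 - 4 * b ^ 3 - g) * y ^ 3"

text \<open>The two kinds of equation have separate tasks: the second-order system determines the
  continuation, while the constraint on \<open>v\<close> confines \<open>y\<close> and selects the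
  energy level of the Weierstrass equation.\<close>

definition trajectory ::
    "real \<Rightarrow> real \<Rightarrow> (real \<Rightarrow> real) \<Rightarrow> (real \<Rightarrow> real) \<Rightarrow> real set \<Rightarrow> bool" where
  "trajectory b g y v U \<longleftrightarrow>
     (\<forall>x\<in>U. (y has_real_derivative v x) (at x) \<and>
            (v has_real_derivative half_quartic_deriv b g (y x)) (at x) \<and>
            (v x)\<^sup>2 = quartic b g (y x))"

lemma trajectory_subset: "trajectory b g y v V \<Longrightarrow> U \<subseteq> V \<Longrightarrow> trajectory b g y v U"
  by (auto simp: trajectory_def)

lemma trajectory_cong:
  assumes "trajectory b g y v U" "open U" "\<And>x. x \<in> U \<Longrightarrow> y' x = y x" "\<And>x. x \<in> U \<Longrightarrow> v' x = v x"
  shows "trajectory b g y' v' U"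
  unfolding trajectory_def
proof (intro ballI conjI)
  fix x assume x: "x \<in> U"
  show "(y' has_real_derivative v' x) (at x)"
    using assms x by (intro has_field_derivative_transform_within_open[of y "v' x" x U y']) (auto simp: trajectory_def)
  show "(v' has_real_derivative half_quartic_deriv b g (y' x)) (at x)"
    using assms x by (intro has_field_derivative_transform_within_open[of v _ x U v']) (auto simp: trajectory_def)
  show "(v' x)\<^sup>2 = quartic b g (y' x)"
    using assms x by (auto simp: trajectory_def)
qed

lemma has_real_derivative_quartic:
  assumes "(y has_real_derivative v) (at x)"
  shows "((\<lambda>x. quartic b g (y x)) has_real_derivative 2 * half_quartic_deriv b g (y x) * v) (at x)"
  unfolding quartic_def half_quartic_deriv_def
  by (rule derivative_eq_intros assms refl)+ (simp add: eval_nat_numeral algebra_simps)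

lemma quartic_eq:
  assumes "y \<noteq> 0"
  shows "quartic b g y = y ^ 4 * (4 * (1 / y - b) ^ 3 + (1 / y - b)\<^sup>2 - g)"
  using assms unfolding quartic_def by (simp add: field_simps eval_nat_numeral)

text \<open>Homogenized forms of R and R'/2, for clearing the denominator D = H + 4 b s: there both
  y D and (1 - b y) D are simple expressions in s and H.\<close>

lemma quartic_scale:
  "quartic b g y * D ^ 4 =
     4 * (y * D) * ((1 - b * y) * D) ^ 3 + (y * D)\<^sup>2 * ((1 - b * y) * D)\<^sup>2 - g * (y * D) ^ 4"
  unfolding quartic_def by (simp add: algebra_simps eval_nat_numeral)

lemma half_quartic_deriv_scale:
  "half_quartic_deriv b g y * D ^ 3 =
     2 * D ^ 3 + (1 - 12 * b) * (y * D) * D\<^sup>2 + (18 * b\<^sup>2 - 3 * b) * (y * D)\<^sup>2 * D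
     + 2 * (b\<^sup>2 - 4 * b ^ 3 - g) * (y * D) ^ 3"
  unfolding half_quartic_deriv_def by (simp add: algebra_simps eval_nat_numeral)

section \<open>Confinement of trajectories to the unit interval\<close>

lemma cubic_neg:
  fixes g w :: real
  assumes "w \<le> - 1 - \<bar>g\<bar>"
  shows "4 * w ^ 3 + w\<^sup>2 - g < 0"
proof -
  have "1 \<le> w\<^sup>2" using power_mono[of 1 "- w" 2] assms by simp
  have "4 * w ^ 3 + w\<^sup>2 = w\<^sup>2 * (4 * w + 1)"
    by (simp add: algebra_simps eval_nat_numeral)
  also have "\<dots> \<le> 1 * (4 * w + 1)"
    using assms \<open>1 \<le> w\<^sup>2\<close> by (intro mult_right_mono_neg) auto
  finally have "4 * w ^ 3 + w\<^sup>2 \<le> 4 * w + 1" by simp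
  moreover have "- \<bar>g\<bar> \<le> g" by linarith
  moreover have "0 \<le> \<bar>g\<bar>" by simp
  ultimately show ?thesis using assms by linarith
qed

text \<open>Outside [0, 1) one has 1/y \<le> 1, so the 2 in \<open>b\<close> pushes 1/y - b down to
  -1 - |g| or below, where \<open>cubic_neg\<close> applies.\<close>

lemma quartic_nonneg_imp_bounds:
  assumes "b = 2 + \<bar>g\<bar>" "0 \<le> quartic b g y"
  shows "0 \<le> y" "y < 1"
proof -
  have "\<not> (y < 0 \<or> 1 \<le> y)"
  proof
    assume y: "y < 0 \<or> 1 \<le> y"
    then have "1 / y - b \<le> - 1 - \<bar>g\<bar>"
      using assms(1) by (auto simp: field_simps)
    from cubic_neg[OF this] have "quartic b g y < 0"
      using y by (subst quartic_eq) (auto simp: mult_pos_neg)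
    then show False using assms(2) by simp
  qed
  then show "0 \<le> y" "y < 1" by auto
qed

lemma trajectory_bounds:
  assumes "b = 2 + \<bar>g\<bar>" "trajectory b g y v U" "x \<in> U"
  shows "0 \<le> y x" "y x < 1"
proof -
  have "quartic b g (y x) = (v x)\<^sup>2" using assms(2,3) by (auto simp: trajectory_def)
  then have "0 \<le> quartic b g (y x)" by simp
  then show "0 \<le> y x" "y x < 1" by (rule quartic_nonneg_imp_bounds[OF assms(1)])+
qed

section \<open>Uniqueness by a Gronwall estimate\<close>

lemma gronwall_zero:
  fixes E E' :: "real \<Rightarrow> real"
  assumes "is_interval U" "x0 \<in> U" "x \<in> U"
    and deriv: "\<And>t. t \<in> U \<Longrightarrow> (E has_real_derivative E' t) (at t)"
    and bound: "\<And>t. t \<in> U \<Longrightarrow> \<bar>E' t\<bar> \<le> C * E t"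
    and nonneg: "\<And>t. t \<in> U \<Longrightarrow> 0 \<le> E t"
    and "E x0 = 0"
  shows "E x = 0"
proof (cases "x0 \<le> x")
  case True
  have sub: "t \<in> U" if "x0 \<le> t" "t \<le> x" for t
    using mem_is_interval_1_I[OF assms(1-3)] that by simp
  have "E x * exp (- C * x) \<le> E x0 * exp (- C * x0)"
  proof (rule DERIV_nonpos_imp_nonincreasing[OF True])
    fix t assume t: "x0 \<le> t" "t \<le> x"
    have "((\<lambda>t. E t * exp (- C * t)) has_real_derivative (E' t - C * E t) * exp (- C * t)) (at t)"
      using deriv[OF sub[OF t]] by (auto intro!: derivative_eq_intros simp: algebra_simps)
    moreover have "(E' t - C * E t) * exp (- C * t) \<le> 0"
      using bound[OF sub[OF t]] by (intro mult_nonpos_nonneg) auto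
    ultimately show "\<exists>y. ((\<lambda>t. E t * exp (- C * t)) has_real_derivative y) (at t) \<and> y \<le> 0" by blast
  qed
  then show ?thesis using assms(7) nonneg[OF assms(3)] by (simp add: mult_le_0_iff)
next
  case False
  then have le: "x \<le> x0" by simp
  have sub: "t \<in> U" if "x \<le> t" "t \<le> x0" for t
    using mem_is_interval_1_I[OF assms(1,3,2)] that by simp
  have "E x * exp (C * x) \<le> E x0 * exp (C * x0)"
  proof (rule DERIV_nonneg_imp_nondecreasing[OF le])
    fix t assume t: "x \<le> t" "t \<le> x0"
    have "((\<lambda>t. E t * exp (C * t)) has_real_derivative (E' t + C * E t) * exp (C * t)) (at t)"
      using deriv[OF sub[OF t]] by (auto intro!: derivative_eq_intros simp: algebra_simps)
    moreover have "0 \<le> (E' t + C * E t) * exp (C * t)"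
      using bound[OF sub[OF t]] by (intro mult_nonneg_nonneg) auto
    ultimately show "\<exists>y. ((\<lambda>t. E t * exp (C * t)) has_real_derivative y) (at t) \<and> 0 \<le> y" by blast
  qed
  then show ?thesis using assms(7) nonneg[OF assms(3)] by (simp add: mult_le_0_iff)
qed

lemma half_quartic_deriv_lipschitz:
  obtains L where "0 \<le> L"
    "\<And>y z. 0 \<le> y \<Longrightarrow> y \<le> 1 \<Longrightarrow> 0 \<le> z \<Longrightarrow> z \<le> 1 \<Longrightarrow>
      \<bar>half_quartic_deriv b g y - half_quartic_deriv b g z\<bar> \<le> L * \<bar>y - z\<bar>"
proof -
  define c1 c2 c3 where "c1 = 1 - 12 * b" and "c2 = 18 * b\<^sup>2 - 3 * b" and "c3 = 2 * (b\<^sup>2 - 4 * b ^ 3 - g)"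
  let ?L = "\<bar>c1\<bar> + \<bar>c2\<bar> * 2 + \<bar>c3\<bar> * 3"
  have "\<bar>half_quartic_deriv b g y - half_quartic_deriv b g z\<bar> \<le> ?L * \<bar>y - z\<bar>"
    if "0 \<le> y" "y \<le> 1" "0 \<le> z" "z \<le> 1" for y z
  proof -
    have "half_quartic_deriv b g y - half_quartic_deriv b g z
        = (c1 + c2 * (y + z) + c3 * (y * y + y * z + z * z)) * (y - z)"
      unfolding half_quartic_deriv_def c1_def c2_def c3_def by (simp add: algebra_simps eval_nat_numeral)
    moreover have "\<bar>c1 + c2 * (y + z) + c3 * (y * y + y * z + z * z)\<bar> \<le> ?L"
    proof -
      have "y * y \<le> 1" "y * z \<le> 1" "z * z \<le> 1" using that by (auto intro: mult_le_one)
      then have "\<bar>c2 * (y + z)\<bar> \<le> \<bar>c2\<bar> * 2" "\<bar>c3 * (y * y + y * z + z * z)\<bar> \<le> \<bar>c3\<bar> * 3"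
        unfolding abs_mult[of c2] abs_mult[of c3] using that by (auto intro!: mult_left_mono simp: abs_le_iff)
      then show ?thesis by linarith
    qed
    ultimately show ?thesis by (simp add: abs_mult mult_right_mono)
  qed
  then show ?thesis by (intro that[of ?L]) auto
qed

text \<open>The energy is the squared distance in the phase plane. Confinement lets one Lipschitz
  constant L serve for all times, and 2 p q \<le> p^2 + q^2 gives the growth rate 1 + L.\<close>

lemma trajectory_unique:
  assumes b: "b = 2 + \<bar>g\<bar>"
    and "trajectory b g y v U" "trajectory b g z w U" "is_interval U" "x0 \<in> U"
    and "y x0 = z x0" "v x0 = w x0" "x \<in> U"
  shows "y x = z x" "v x = w x"
proof -
  obtain L where L: "0 \<le> L"
    "\<And>y z. 0 \<le> y \<Longrightarrow> y \<le> 1 \<Longrightarrow> 0 \<le> z \<Longrightarrow> z \<le> 1 \<Longrightarrow>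
      \<bar>half_quartic_deriv b g y - half_quartic_deriv b g z\<bar> \<le> L * \<bar>y - z\<bar>"
    using half_quartic_deriv_lipschitz by blast
  define E where "E = (\<lambda>t. (y t - z t)\<^sup>2 + (v t - w t)\<^sup>2)"
  define E' where "E' = (\<lambda>t. 2 * (y t - z t) * (v t - w t)
      + 2 * (v t - w t) * (half_quartic_deriv b g (y t) - half_quartic_deriv b g (z t)))"
  have "E x = 0"
  proof (rule gronwall_zero[OF assms(4,5,8), of E E' "1 + L"])
    fix t assume t: "t \<in> U"
    have d: "(y has_real_derivative v t) (at t)" "(v has_real_derivative half_quartic_deriv b g (y t)) (at t)"
      "(z has_real_derivative w t) (at t)" "(w has_real_derivative half_quartic_deriv b g (z t)) (at t)"
      using assms(2,3) t by (auto simp: trajectory_def)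
    show "(E has_real_derivative E' t) (at t)"
      unfolding E_def E'_def by (rule derivative_eq_intros d refl)+ (simp add: algebra_simps)
    let ?p = "\<bar>y t - z t\<bar>" and ?q = "\<bar>v t - w t\<bar>"
    have lip: "\<bar>half_quartic_deriv b g (y t) - half_quartic_deriv b g (z t)\<bar> \<le> L * ?p"
      using trajectory_bounds[OF b assms(2) t] trajectory_bounds[OF b assms(3) t] by (intro L) auto
    have "\<bar>E' t\<bar> \<le> \<bar>2 * (y t - z t) * (v t - w t)\<bar>
        + \<bar>2 * (v t - w t) * (half_quartic_deriv b g (y t) - half_quartic_deriv b g (z t))\<bar>"
      unfolding E'_def by (rule abs_triangle_ineq)
    also have "\<dots> \<le> 2 * ?p * ?q + 2 * ?q * (L * ?p)"
      unfolding abs_mult abs_numeral by (intro add_left_mono mult_left_mono lip) auto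
    also have "\<dots> = (1 + L) * (2 * ?p * ?q)" by (simp add: algebra_simps)
    also have "\<dots> \<le> (1 + L) * (?p\<^sup>2 + ?q\<^sup>2)"
      using L(1) sum_squares_bound[of ?p ?q] by (intro mult_left_mono) auto
    finally show "\<bar>E' t\<bar> \<le> (1 + L) * E t" by (simp add: E_def)
    show "0 \<le> E t" by (simp add: E_def)
  qed (use assms(6,7) in \<open>simp add: E_def\<close>)
  then show "y x = z x" "v x = w x"
    by (auto simp: E_def sum_power2_eq_zero_iff)
qed

text \<open>The point is the order of quantifiers: \<open>e\<close> is chosen before the initial
  data. This is possible because the constraint leaves only a bounded set of data.\<close>

lemma trajectory_local:
  assumes b: "b = 2 + \<bar>g\<bar>"
  obtains e :: real where "0 < e"
    "\<And>x0 y0 v0. v0\<^sup>2 = quartic b g y0 \<Longrightarrow>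
       \<exists>y v. y x0 = y0 \<and> v x0 = v0 \<and> real_analytic_at y x0 \<and> trajectory b g y v {x0 - e<..<x0 + e}"
proof -
  define c1 c2 c3 where "c1 = 1 - 12 * b" and "c2 = 18 * b\<^sup>2 - 3 * b" and "c3 = 2 * (b\<^sup>2 - 4 * b ^ 3 - g)"
  have "compact (quartic b g ` {0..1})"
    by (intro compact_continuous_image) (auto simp: quartic_def intro!: continuous_intros)
  then obtain B where B: "\<And>y. 0 \<le> y \<Longrightarrow> y \<le> 1 \<Longrightarrow> \<bar>quartic b g y\<bar> \<le> B"
    by (fastforce simp: compact_eq_bounded_closed bounded_iff)
  have B0: "0 \<le> B" using B[of 0] by (simp add: quartic_def)
  \<comment> \<open>Three demands on K are met at once: K is at least 1, K^2 dominates the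
    coefficients, and |v0| \<le> K because v0^2 \<le> B < K \<le> K^2.\<close>
  define K where "K = 1 + B + (\<bar>2\<bar> + \<bar>c1\<bar> + \<bar>c2\<bar> + \<bar>c3\<bar>)"
  have K1: "1 \<le> K" using B0 by (simp add: K_def)
  have K2: "\<bar>2\<bar> + \<bar>c1\<bar> + \<bar>c2\<bar> + \<bar>c3\<bar> \<le> K\<^sup>2"
  proof -
    have "\<bar>2\<bar> + \<bar>c1\<bar> + \<bar>c2\<bar> + \<bar>c3\<bar> \<le> K * 1" using B0 by (simp add: K_def)
    also have "\<dots> \<le> K * K" using K1 by (intro mult_left_mono) auto
    finally show ?thesis by (simp add: power2_eq_square)
  qed
  show ?thesis
  proof (rule that[of "1 / K"])
    show "0 < 1 / K" using K1 by simp
  next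
    fix x0 y0 v0 :: real
    assume v0: "v0\<^sup>2 = quartic b g y0"
    have y0: "0 \<le> y0" "y0 < 1" by (rule quartic_nonneg_imp_bounds[OF b], simp flip: v0)+
    have "\<bar>v0\<bar> \<le> K"
    proof (rule ccontr)
      assume "\<not> \<bar>v0\<bar> \<le> K"
      then have "K * K \<le> v0\<^sup>2" using power_mono[of K "\<bar>v0\<bar>" 2] K1 by (simp add: power2_eq_square)
      moreover have "v0\<^sup>2 \<le> B" using v0 B[of y0] y0 by simp
      moreover have "K * 1 \<le> K * K" using K1 by (intro mult_left_mono) auto
      moreover have "B < K" by (simp add: K_def)
      ultimately show False by linarith
    qed
    then obtain y v where yv: "y x0 = y0" "v x0 = v0" "real_analytic_at y x0"
      "\<And>x. \<bar>x - x0\<bar> < 1 / K \<Longrightarrow> (y has_real_derivative v x) (at x)"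
      "\<And>x. \<bar>x - x0\<bar> < 1 / K \<Longrightarrow> (v has_real_derivative 2 + c1 * y x + c2 * y x ^ 2 + c3 * y x ^ 3) (at x)"
      using cubic_ode_local_solution[of y0 v0 K 2 c1 c2 c3 x0] y0 K1 K2 by auto
    let ?U = "{x0 - 1 / K<..<x0 + 1 / K}"
    have d: "(y has_real_derivative v x) (at x)" "(v has_real_derivative half_quartic_deriv b g (y x)) (at x)"
      if "x \<in> ?U" for x
      using that yv(4,5)[of x] by (auto simp: half_quartic_deriv_def c1_def c2_def c3_def abs_less_iff)
    \<comment> \<open>Conservation of energy: v^2 - R(y) has derivative 2 v R'(y)/2 - R'(y) v = 0,
      so the constraint propagates from x0.\<close>
    have "(v x)\<^sup>2 - quartic b g (y x) = (v x0)\<^sup>2 - quartic b g (y x0)" if "x \<in> ?U" for x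
    proof (rule DERIV_isconst3[where a = "x0 - 1 / K" and b = "x0 + 1 / K"
          and f = "\<lambda>x. (v x)\<^sup>2 - quartic b g (y x)"])
      fix t assume t: "t \<in> ?U"
      show "((\<lambda>x. (v x)\<^sup>2 - quartic b g (y x)) has_real_derivative 0) (at t)"
        by (rule derivative_eq_intros d[OF t] has_real_derivative_quartic refl)+ (simp add: algebra_simps)
    qed (use that K1 in auto)
    then have "trajectory b g y v ?U"
      using d v0 yv by (simp add: trajectory_def)
    then show "\<exists>y v. y x0 = y0 \<and> v x0 = v0 \<and> real_analytic_at y x0 \<and> trajectory b g y v ?U"
      using yv by blast
  qed
qed

section \<open>Gluing, analyticity and extension to the whole line\<close>

lemma trajectory_glue:
  assumes b: "b = 2 + \<bar>g\<bar>"
    and "trajectory b g y v U" "trajectory b g z w V" "open U" "open V" "is_interval (U \<inter> V)"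
    and "x1 \<in> U" "x1 \<in> V" "z x1 = y x1" "w x1 = v x1"
  obtains y' v' where "trajectory b g y' v' (U \<union> V)"
    "\<And>x. x \<in> U \<Longrightarrow> y' x = y x" "\<And>x. x \<in> U \<Longrightarrow> v' x = v x"
proof -
  have eq: "y x = z x" "v x = w x" if "x \<in> U" "x \<in> V" for x
    using trajectory_unique[OF b, of y v "U \<inter> V" z w x1 x] assms that
    by (auto intro: trajectory_subset)
  define y' where "y' = (\<lambda>x. if x \<in> U then y x else z x)"
  define v' where "v' = (\<lambda>x. if x \<in> U then v x else w x)"
  have "trajectory b g y' v' U" using assms(2,4) by (rule trajectory_cong) (auto simp: y'_def v'_def)
  moreover have "trajectory b g y' v' V" using assms(3,5) by (rule trajectory_cong) (auto simp: y'_def v'_def eq)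
  ultimately have "trajectory b g y' v' (U \<union> V)" by (auto simp: trajectory_def)
  then show ?thesis by (rule that) (auto simp: y'_def v'_def)
qed

text \<open>By uniqueness the trajectory coincides near x with the power series solution that has
  the same data at x.\<close>

lemma trajectory_analytic:
  assumes b: "b = 2 + \<bar>g\<bar>" and "trajectory b g y v U" "open U" "x \<in> U"
  shows "real_analytic_at y x"
proof -
  obtain e where e: "0 < e" and loc:
    "\<And>x0 y0 v0. v0\<^sup>2 = quartic b g y0 \<Longrightarrow>
       \<exists>y v. y x0 = y0 \<and> v x0 = v0 \<and> real_analytic_at y x0 \<and> trajectory b g y v {x0 - e<..<x0 + e}"
    using trajectory_local[OF b] by blast
  obtain d where d: "0 < d" "ball x d \<subseteq> U" using assms(3,4) openE by blast
  obtain z w where zw: "z x = y x" "w x = v x" "real_analytic_at z x" "trajectory b g z w {x - e<..<x + e}"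
    using loc[of "v x" "y x" x] assms(2,4) by (auto simp: trajectory_def)
  let ?V = "ball x (min d e)"
  have "trajectory b g y v ?V" using assms(2) d by (auto elim!: trajectory_subset)
  moreover have "trajectory b g z w ?V" using zw(4) by (rule trajectory_subset) (auto simp: dist_real_def)
  ultimately have eq: "z t = y t" if "t \<in> ?V" for t
    using trajectory_unique[OF b, of y v ?V z w x t] zw(1,2) d(1) e that by (auto simp: is_interval_ball_real)
  obtain F where F: "(\<lambda>h. z (x + h)) has_fps_expansion F" using zw(3) by (auto simp: real_analytic_at_def)
  have "eventually (\<lambda>h. h \<in> ball 0 (min d e)) (nhds 0)"
    using d(1) e by (intro eventually_nhds_in_open) auto
  then have "eventually (\<lambda>h. z (x + h) = y (x + h)) (nhds 0)"
    by eventually_elim (rule eq, auto simp: dist_real_def)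
  then have "(\<lambda>h. y (x + h)) has_fps_expansion F"
    using F unfolding has_fps_expansion_def by (auto elim: eventually_elim2)
  then show ?thesis by (auto simp: real_analytic_at_def)
qed

lemma trajectory_global:
  assumes b: "b = 2 + \<bar>g\<bar>" and init: "v0\<^sup>2 = quartic b g y0"
  obtains y v where "y x0 = y0" "v x0 = v0" "trajectory b g y v UNIV"
proof -
  obtain e where e: "0 < e" and loc:
    "\<And>x0 y0 v0. v0\<^sup>2 = quartic b g y0 \<Longrightarrow>
       \<exists>y v. y x0 = y0 \<and> v x0 = v0 \<and> real_analytic_at y x0 \<and> trajectory b g y v {x0 - e<..<x0 + e}"
    using trajectory_local[OF b] by blast
  \<comment> \<open>A local solution centred e/2 inside an end point has radius e, so it overlaps
    the old interval and reaches e/2 beyond it.\<close>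
  define r where "r = (\<lambda>n. e + real n * (e / 2))"
  define J where "J = (\<lambda>n. {x0 - r n<..<x0 + r n})"
  have "\<exists>y v. y x0 = y0 \<and> v x0 = v0 \<and> trajectory b g y v (J n)" for n
  proof (induction n)
    case 0
    then show ?case using loc[OF init, of x0] by (auto simp: J_def r_def)
  next
    case (Suc n)
    then obtain y v where yv: "y x0 = y0" "v x0 = v0" "trajectory b g y v (J n)" by blast
    define R where "R = r n"
    have R: "e \<le> R" "r (Suc n) = R + e / 2" using e by (simp_all add: R_def r_def field_simps)
    let ?p = "x0 + R - e / 2" and ?q = "x0 - R + e / 2"
    have U: "trajectory b g y v {x0 - R<..<x0 + R}" using yv(3) by (simp add: J_def R_def)
    obtain z w where zw: "z ?p = y ?p" "w ?p = v ?p" "trajectory b g z w {?p - e<..<?p + e}"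
      using loc[of "v ?p" "y ?p" ?p] U e R by (auto simp: trajectory_def)
    obtain y1 v1 where 1: "trajectory b g y1 v1 ({x0 - R<..<x0 + R} \<union> {?p - e<..<?p + e})"
      "\<And>x. x \<in> {x0 - R<..<x0 + R} \<Longrightarrow> y1 x = y x" "\<And>x. x \<in> {x0 - R<..<x0 + R} \<Longrightarrow> v1 x = v x"
      using trajectory_glue[OF b U zw(3), of ?p] zw(1,2) e R by (auto intro: is_interval_Int)
    have U1: "trajectory b g y1 v1 {x0 - R<..<x0 + R + e / 2}"
      using 1(1) by (rule trajectory_subset) (use e R in auto)
    obtain z w where zw: "z ?q = y1 ?q" "w ?q = v1 ?q" "trajectory b g z w {?q - e<..<?q + e}"
      using loc[of "v1 ?q" "y1 ?q" ?q] U1 e R by (auto simp: trajectory_def)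
    obtain y2 v2 where 2: "trajectory b g y2 v2 ({x0 - R<..<x0 + R + e / 2} \<union> {?q - e<..<?q + e})"
      "\<And>x. x \<in> {x0 - R<..<x0 + R + e / 2} \<Longrightarrow> y2 x = y1 x"
      "\<And>x. x \<in> {x0 - R<..<x0 + R + e / 2} \<Longrightarrow> v2 x = v1 x"
      using trajectory_glue[OF b U1 zw(3), of ?q] zw(1,2) e R by (auto intro: is_interval_Int)
    have "trajectory b g y2 v2 (J (Suc n))"
      using 2(1) by (rule trajectory_subset) (use e R in \<open>auto simp: J_def\<close>)
    moreover have "y2 x0 = y0" "v2 x0 = v0" using 1(2,3) 2(2,3) yv e R by auto
    ultimately show ?case by blast
  qed
  then obtain Y V where YV: "\<And>n. Y n x0 = y0" "\<And>n. V n x0 = v0" "\<And>n. trajectory b g (Y n) (V n) (J n)"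
    by metis
  have r_pos: "0 < r n" for n using e by (simp add: r_def add_pos_nonneg)
  then have x0J: "x0 \<in> J n" for n by (simp add: J_def)
  have agree: "Y m x = Y n x" "V m x = V n x" if "x \<in> J m" "x \<in> J n" for m n x
  proof -
    have "is_interval (J m \<inter> J n)" by (simp add: J_def is_interval_Int)
    moreover have "trajectory b g (Y m) (V m) (J m \<inter> J n)" "trajectory b g (Y n) (V n) (J m \<inter> J n)"
      by (rule trajectory_subset[OF YV(3)], blast)+
    ultimately show "Y m x = Y n x" "V m x = V n x"
      using trajectory_unique[OF b, of "Y m" "V m" "J m \<inter> J n" "Y n" "V n" x0 x] YV(1,2) x0J that
      by auto
  qed
  have ex: "\<exists>n. x \<in> J n" for x
  proof -
    obtain n where "\<bar>x - x0\<bar> < real n * (e / 2)" using reals_Archimedean3[of "e / 2"] e by auto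
    then have "\<bar>x - x0\<bar> < r n" using e by (simp add: r_def)
    then show ?thesis by (intro exI[of _ n]) (auto simp: J_def abs_less_iff)
  qed
  \<comment> \<open>An arbitrary but fixed choice of an interval containing x; by
    \<open>agree\<close> the values do not depend on it.\<close>
  define N where "N = (\<lambda>x. LEAST n. x \<in> J n)"
  have N: "x \<in> J (N x)" for x using ex LeastI_ex unfolding N_def by metis
  have "trajectory b g (\<lambda>x. Y (N x) x) (\<lambda>x. V (N x) x) (J n)" for n
  proof (rule trajectory_cong[OF YV(3)])
    show "open (J n)" by (simp add: J_def)
  qed (use agree N in blast)+
  then have "trajectory b g (\<lambda>x. Y (N x) x) (\<lambda>x. V (N x) x) UNIV"
    using ex by (fastforce simp: trajectory_def)
  then show ?thesis using YV by (intro that) auto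
qed

section \<open>Real forms of the Weierstrass function\<close>

lemma real_analytic_at_cong:
  assumes "real_analytic_at f x" "eventually (\<lambda>z. f z = f' z) (nhds x)"
  shows "real_analytic_at f' x"
proof -
  obtain F where F: "(\<lambda>h. f (x + h)) has_fps_expansion F" using assms(1) by (auto simp: real_analytic_at_def)
  have "filterlim (\<lambda>h. x + h) (nhds x) (nhds 0)"
    by (auto intro!: tendsto_eq_intros filterlim_ident)
  then have "eventually (\<lambda>h. f (x + h) = f' (x + h)) (nhds 0)"
    using assms(2) by (auto simp: filterlim_iff)
  then have "(\<lambda>h. f' (x + h)) has_fps_expansion F"
    using F unfolding has_fps_expansion_def by (auto elim: eventually_elim2)
  then show ?thesis by (auto simp: real_analytic_at_def)
qed

lemma real_analytic_at_inverse_add_const: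
  assumes "real_analytic_at f x" "f x \<noteq> 0"
  shows "real_analytic_at (\<lambda>z. 1 / f z + c) x"
proof -
  obtain F where F: "(\<lambda>h. f (x + h)) has_fps_expansion F" using assms(1) by (auto simp: real_analytic_at_def)
  have "fps_nth F 0 = f x" using F by (auto simp: has_fps_expansion_def eval_fps_at_0 dest: eventually_nhds_x_imp_x)
  then have "(\<lambda>h. inverse (f (x + h)) + c) has_fps_expansion (inverse F + fps_const c)"
    using F assms(2) by (intro has_fps_expansion_add has_fps_expansion_inverse) auto
  then show ?thesis by (auto simp: real_analytic_at_def inverse_eq_divide)
qed

lemma trajectory_imp_weierstrass_real_form:
  assumes b: "b = 2 + \<bar>g\<bar>" and traj: "trajectory b g y v UNIV" and nonconst: "\<not> y constant_on UNIV"
  shows "weierstrass_real_form (1 / 12) (g - 1 / 216)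
           (\<lambda>x. if y x = 0 then \<infinity> else ereal (1 / y x - b + 1 / 12))"
proof -
  define Q where "Q = (\<lambda>x. if y x = 0 then \<infinity> else ereal (1 / y x - b + 1 / 12))"
  have dy: "(y has_real_derivative v x) (at x)"
    and dv: "(v has_real_derivative half_quartic_deriv b g (y x)) (at x)"
    and v2: "(v x)\<^sup>2 = quartic b g (y x)" for x
    using traj by (auto simp: trajectory_def)
  have y_nonneg: "0 \<le> y x" for x using trajectory_bounds[OF b traj] by auto
  have cont: "isCont y x" for x using dy DERIV_isCont by blast
  have v0: "v x = 0" if "y x = 0" for x using v2[of x] that by (simp add: quartic_def)
  have "\<not> Q constant_on UNIV"
  proof
    assume "Q constant_on UNIV"
    then obtain c where c: "\<And>x. Q x = c" by (auto simp: constant_on_def)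
    have "y x = (if c = \<infinity> then 0 else 1 / (real_of_ereal c + b - 1 / 12))" for x
      using c[of x] by (auto simp: Q_def split: if_splits)
    then have "y constant_on UNIV" unfolding constant_on_def by blast
    then show False using nonconst by contradiction
  qed
  moreover have "Q x \<noteq> -\<infinity>" for x by (simp add: Q_def)
  moreover have "(\<forall>\<^sub>F z in at x. Q z \<noteq> \<infinity>) \<and> (Q \<longlongrightarrow> \<infinity>) (at x)" if "Q x = \<infinity>" for x
  proof -
    have y0: "y x = 0" using that by (auto simp: Q_def split: if_splits)
    \<comment> \<open>At a zero of \<open>y\<close> also v = 0, but v' = 2. Hence v is nonzero
      nearby, and by \<open>v0\<close> so is y: the poles of Q are isolated.\<close>
    then have "((\<lambda>z. (v z - v x) / (z - x)) \<longlongrightarrow> 2) (at x)"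
      using dv[of x] by (simp add: has_field_derivative_iff half_quartic_deriv_def)
    then have "\<forall>\<^sub>F z in at x. (v z - v x) / (z - x) \<noteq> 0"
      by (rule tendsto_imp_eventually_ne) simp
    then have ev: "\<forall>\<^sub>F z in at x. y z \<noteq> 0"
      by eventually_elim (use v0 y0 in auto)
    have "(y \<longlongrightarrow> 0) (at x)" using cont[of x] y0 by (simp add: isCont_def)
    \<comment> \<open>Nonnegativity of \<open>y\<close> makes the limit of 1/y equal to plus
      infinity from both sides.\<close>
    then have "filterlim (\<lambda>z. inverse (y z)) at_top (at x)"
      using ev y_nonneg by (intro filterlim_inverse_at_top) (auto elim!: eventually_mono simp: order_less_le)
    then have "filterlim (\<lambda>z. (1 / 12 - b) + inverse (y z)) at_top (at x)"
      by (intro filterlim_tendsto_add_at_top[OF tendsto_const])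
    then have "((\<lambda>z. ereal ((1 / 12 - b) + inverse (y z))) \<longlongrightarrow> \<infinity>) (at x)"
      by (simp add: tendsto_PInfty_eq_at_top)
    moreover have "\<forall>\<^sub>F z in at x. ereal ((1 / 12 - b) + inverse (y z)) = Q z"
      using ev by eventually_elim (simp add: Q_def inverse_eq_divide)
    ultimately have "(Q \<longlongrightarrow> \<infinity>) (at x)" by (rule Lim_transform_eventually)
    then show ?thesis using ev by (auto simp: Q_def elim: eventually_mono)
  qed
  moreover have "real_analytic_at (\<lambda>z. real_of_ereal (Q z)) x \<and>
      (deriv (\<lambda>z. real_of_ereal (Q z)) x)\<^sup>2 =
        4 * real_of_ereal (Q x) ^ 3 - 1 / 12 * real_of_ereal (Q x) - (g - 1 / 216)" if "Q x \<noteq> \<infinity>" for x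
  proof -
    have y0: "y x \<noteq> 0" using that by (auto simp: Q_def)
    define q where "q = (\<lambda>z. 1 / y z + (1 / 12 - b))"
    \<comment> \<open>\<open>real_of_ereal\<close> sends infinity to 0, so comparing it with
      \<open>q\<close> requires a neighbourhood without zeros of \<open>y\<close>.\<close>
    have "open {z. y z \<noteq> 0}"
      using cont by (intro open_Collect_neq continuous_at_imp_continuous_on continuous_on_const) auto
    then have "\<forall>\<^sub>F z in nhds x. y z \<noteq> 0"
      using y0 eventually_nhds_in_open[of "{z. y z \<noteq> 0}" x] by simp
    then have ev: "\<forall>\<^sub>F z in nhds x. q z = real_of_ereal (Q z)"
      by eventually_elim (simp add: q_def Q_def)
    have "real_analytic_at q x"
      unfolding q_def using trajectory_analytic[OF b traj] y0 by (intro real_analytic_at_inverse_add_const) auto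
    then have "real_analytic_at (\<lambda>z. real_of_ereal (Q z)) x" using ev by (rule real_analytic_at_cong)
    moreover have "(q has_real_derivative - v x / (y x)\<^sup>2) (at x)"
      unfolding q_def by (rule derivative_eq_intros dy refl y0)+ (simp add: power2_eq_square)
    then have "deriv q x = - v x / (y x)\<^sup>2" by (rule DERIV_imp_deriv)
    then have "deriv (\<lambda>z. real_of_ereal (Q z)) x = - v x / (y x)\<^sup>2"
      using deriv_cong_ev[OF ev refl] by simp
    moreover have "(- v x / (y x)\<^sup>2)\<^sup>2 = quartic b g (y x) / y x ^ 4"
      using v2[of x] by (simp add: power_divide flip: power_mult)
    moreover have "quartic b g (y x) / y x ^ 4 = 4 * (1 / y x - b) ^ 3 + (1 / y x - b)\<^sup>2 - g"
      using y0 by (simp add: quartic_eq)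
    moreover have "\<dots> = 4 * q x ^ 3 - 1 / 12 * q x - (g - 1 / 216)"
    proof -
      define w where "w = 1 / y x - b"
      have "q x = w + 1 / 12" by (simp add: q_def w_def)
      then show ?thesis unfolding w_def[symmetric] by (simp add: algebra_simps eval_nat_numeral)
    qed
    ultimately show ?thesis using eventually_nhds_x_imp_x[OF ev] by simp
  qed
  ultimately show ?thesis unfolding weierstrass_real_form_def Q_def[symmetric] by blast
qed

text \<open>L'Hopital's rule for the difference quotient. It serves at zeros of \<open>s\<close>,
  where the equations are known only at nearby times.\<close>

lemma has_real_derivative_removable:
  fixes f f' :: "real \<Rightarrow> real"
  assumes "isCont f x" "\<forall>\<^sub>F t in at x. (f has_real_derivative f' t) (at t)" "(f' \<longlongrightarrow> l) (at x)"
  shows "(f has_real_derivative l) (at x)"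
  unfolding has_field_derivative_iff
proof (rule lhopital[where f' = f' and g' = "\<lambda>_. 1"])
  show "((\<lambda>t. f t - f x) \<longlongrightarrow> 0) (at x)" using assms(1) by (simp add: isCont_def LIM_zero)
  show "((\<lambda>t. t - x) \<longlongrightarrow> 0) (at x)" by (auto intro!: tendsto_eq_intros)
  show "\<forall>\<^sub>F t in at x. t - x \<noteq> 0" by (simp add: eventually_at_filter)
  show "\<forall>\<^sub>F t in at x. ((\<lambda>t. f t - f x) has_real_derivative f' t) (at t)"
    using assms(2) by eventually_elim (auto intro!: derivative_eq_intros)
  show "\<forall>\<^sub>F t in at x. ((\<lambda>t. t - x) has_real_derivative 1) (at t)"
    by (intro always_eventually allI) (auto intro!: derivative_eq_intros)
qed (use assms(3) in auto)

section \<open>The scale function and its zeros\<close>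

lemma open_eventually_nhds: "open {t. eventually P (nhds t)}"
proof (rule topological_space_class.openI)
  fix x assume "x \<in> {t. eventually P (nhds t)}"
  then obtain T where "open T" "x \<in> T" "\<forall>z\<in>T. P z" by (auto simp: eventually_nhds)
  then have "T \<subseteq> {t. eventually P (nhds t)}" unfolding eventually_nhds by blast
  then show "\<exists>T. open T \<and> x \<in> T \<and> T \<subseteq> {t. eventually P (nhds t)}" using \<open>open T\<close> \<open>x \<in> T\<close> by blast
qed

locale critical_universe =
  fixes I :: "real set" and s :: "real \<Rightarrow> real" and t0 H \<aa> :: real
  assumes RW: "closed_RW I s t0"
    and nonconst: "\<not> s constant_on I"
    and params: "internal_parameters I s H \<aa>"
    and H: "H \<noteq> 0"
begin

lemma open_I: "open I" and interval_I: "is_interval I" and t0_I: "t0 \<in> I"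
  and s_nonneg: "t \<in> I \<Longrightarrow> 0 \<le> s t" and s_cont: "continuous_on I s"
  and inverse_s_finite: "a \<in> I \<Longrightarrow> c \<in> I \<Longrightarrow> (\<integral>\<^sup>+u\<in>{a..c}. inverse (ennreal (s u)) \<partial>lborel) < \<infinity>"
  and time_cont: "continuous_on I (conformal_time s t0)"
  and time_strict_mono: "strict_mono_on I (conformal_time s t0)"
  and time_inverse_differentiable:
    "(inv_into I (conformal_time s t0)) differentiable_on (conformal_time s t0 ` I)"
  using RW by (auto simp: closed_RW_def)

section \<open>The second-order equation for \<open>s\<close>, also at its critical points\<close>

lemma isCont_s: "t \<in> I \<Longrightarrow> isCont s t"
  using s_cont open_I by (simp add: continuous_on_eq_continuous_at)

lemma deriv_s: "t \<in> I \<Longrightarrow> 0 < s t \<Longrightarrow> (s has_real_derivative deriv s t) (at t)"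
  and deriv2_s: "t \<in> I \<Longrightarrow> 0 < s t \<Longrightarrow> (deriv s has_real_derivative deriv (deriv s) t) (at t)"
  and isCont_deriv2_s: "t \<in> I \<Longrightarrow> 0 < s t \<Longrightarrow> isCont (deriv (deriv s)) t"
proof -
  assume t: "t \<in> I" "0 < s t"
  have *: "((deriv ^^ n) s) differentiable (at t)" for n
    using RW t by (auto simp: closed_RW_def)
  show "(s has_real_derivative deriv s t) (at t)"
    using *[of 0] by (simp add: DERIV_deriv_iff_real_differentiable)
  show "(deriv s has_real_derivative deriv (deriv s) t) (at t)"
    using *[of 1] by (simp add: DERIV_deriv_iff_real_differentiable)
  show "isCont (deriv (deriv s)) t"
    using *[of 2] by (auto simp: numeral_2_eq_2 intro: differentiable_imp_continuous_within)
qed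

lemma first_integral: "t \<in> I \<Longrightarrow> 0 < s t \<Longrightarrow> s t * ((deriv s t)\<^sup>2 + \<aa> / 3 * (s t)\<^sup>2 - 1) = H"
  using params by (auto simp: internal_parameters_def)

lemma open_positive: "open {t \<in> I. 0 < s t}"
proof -
  have "open (s -` {0<..} \<inter> I)" using s_cont open_I by (simp add: continuous_on_open_vimage)
  moreover have "s -` {0<..} \<inter> I = {t \<in> I. 0 < s t}" by auto
  ultimately show ?thesis by simp
qed

text \<open>The time derivative of the first integral is
  \<open>deriv s t * euler_lagrange t\<close>.\<close>

definition euler_lagrange :: "real \<Rightarrow> real" where
  "euler_lagrange t = 2 * s t * deriv (deriv s) t + (deriv s t)\<^sup>2 + \<aa> * (s t)\<^sup>2 - 1"

lemma isCont_euler_lagrange: "t \<in> I \<Longrightarrow> 0 < s t \<Longrightarrow> isCont euler_lagrange t"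
  unfolding euler_lagrange_def
  using isCont_s[of t] DERIV_isCont[OF deriv2_s[of t]] isCont_deriv2_s[of t]
  by (intro continuous_intros) auto

lemma critical_or_euler_lagrange:
  assumes t: "t \<in> I" "0 < s t"
  shows "deriv s t = 0 \<or> euler_lagrange t = 0"
proof -
  let ?e = "\<lambda>t. s t * ((deriv s t)\<^sup>2 + \<aa> / 3 * (s t)\<^sup>2 - 1)"
  have "(?e has_real_derivative deriv s t * euler_lagrange t) (at t)"
    unfolding euler_lagrange_def
    by (rule derivative_eq_intros deriv_s deriv2_s t refl)+ (simp add: algebra_simps power2_eq_square)
  moreover have "(?e has_real_derivative 0) (at t)"
    by (rule has_field_derivative_transform_within_open[OF DERIV_const[of H] open_positive])
      (use t first_integral in auto)
  ultimately show ?thesis using DERIV_unique by fastforce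
qed

text \<open>By continuity the second factor of that derivative stays nonzero nearby, so the first
  factor \<open>deriv s\<close> must vanish there.\<close>

lemma locally_constant:
  assumes t: "t \<in> I" "0 < s t" and "euler_lagrange t \<noteq> 0"
  shows "\<forall>\<^sub>F x in nhds t. s x = s t"
proof -
  have "\<forall>\<^sub>F x in at t. euler_lagrange x \<noteq> 0"
    using isCont_euler_lagrange[OF t] assms(3) by (auto simp: isCont_def intro: tendsto_imp_eventually_ne)
  then have "\<forall>\<^sub>F x in nhds t. euler_lagrange x \<noteq> 0"
    using assms(3) by (simp add: eventually_nhds_conv_at)
  moreover have "\<forall>\<^sub>F x in nhds t. x \<in> {t \<in> I. 0 < s t}"
    using open_positive t by (intro eventually_nhds_in_open) auto
  ultimately have "\<forall>\<^sub>F x in nhds t. (s has_real_derivative 0) (at x)"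
  proof eventually_elim
    case (elim x)
    then show ?case using deriv_s[of x] critical_or_euler_lagrange[of x] by simp
  qed
  then obtain d where d: "0 < d" "\<And>x. dist x t < d \<Longrightarrow> (s has_real_derivative 0) (at x)"
    unfolding eventually_nhds_metric by blast
  have "s x = s t" if "dist x t < d" for x
    by (rule DERIV_isconst3[of "t - d" "t + d"]) (use d that in \<open>auto simp: dist_real_def\<close>)
  then show ?thesis unfolding eventually_nhds_metric using d(1) by blast
qed

text \<open>
  Where the Euler-Lagrange expression does not vanish, \<open>s\<close> is locally equal to a constant \<open>c\<close>, and
  the expression has the nonzero value \<open>\<aa> c\<^sup>2 - 1\<close>, which by continuity it keeps at limit points. So
  the set where \<open>s\<close> is locally equal to \<open>c\<close> is open and closed in \<open>I\<close>.
\<close>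

lemma euler_lagrange_eq_0:
  assumes t1: "t1 \<in> I" "0 < s t1"
  shows "euler_lagrange t1 = 0"
proof (rule ccontr)
  assume nz: "euler_lagrange t1 \<noteq> 0"
  define c where "c = s t1"
  define W where "W = {t. \<forall>\<^sub>F x in nhds t. s x = c}"
  have c: "0 < c" using t1 by (simp add: c_def)
  have t1W: "t1 \<in> W" using locally_constant[OF t1 nz] by (simp add: W_def c_def)
  have W_s: "s t = c" if "t \<in> W" for t
    using that eventually_nhds_x_imp_x unfolding W_def by blast
  have W_EL: "euler_lagrange t = \<aa> * c\<^sup>2 - 1" if "t \<in> W" for t
  proof -
    have ev: "\<forall>\<^sub>F x in nhds t. s x = c" using that by (simp add: W_def)
    then have "\<forall>\<^sub>F x in nhds t. \<forall>\<^sub>F z in nhds x. s z = c" by (simp only: eventually_eventually)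
    then have ev': "\<forall>\<^sub>F x in nhds t. deriv s x = 0"
    proof eventually_elim
      case (elim x)
      show ?case using deriv_cong_ev[OF elim refl] by simp
    qed
    have "deriv (deriv s) t = 0" "deriv s t = 0"
      using deriv_cong_ev[OF ev' refl] eventually_nhds_x_imp_x[OF ev'] by simp_all
    then show ?thesis using W_s[OF that] by (simp add: euler_lagrange_def)
  qed
  have open_W: "open W"
    unfolding W_def by (rule open_eventually_nhds)
  have closed: "\<forall>\<^sub>F x in nhds t. x \<notin> W" if t: "t \<in> I" "t \<notin> W" for t
  proof (cases "s t = c")
    case False
    have "\<forall>\<^sub>F x in at t. s x \<noteq> c"
      using isCont_s[OF t(1)] False by (auto simp: isCont_def intro: tendsto_imp_eventually_ne)
    then have "\<forall>\<^sub>F x in nhds t. s x \<noteq> c" using False by (simp add: eventually_nhds_conv_at)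
    then show ?thesis by eventually_elim (use W_s in blast)
  next
    case True
    \<comment> \<open>Otherwise \<open>locally_constant\<close> would put t into \<open>W\<close>.
      But on \<open>W\<close> the expression has the same nonzero value as at \<open>t1\<close>, so
      points of \<open>W\<close> cannot approach t.\<close>
    have EL: "euler_lagrange t = 0"
      using locally_constant[of t] t c True by (auto simp: W_def)
    have "\<forall>\<^sub>F x in at t. euler_lagrange x \<noteq> euler_lagrange t1"
      using isCont_euler_lagrange[of t] t(1) True c EL nz
      by (auto simp: isCont_def intro!: tendsto_imp_eventually_ne)
    then have "\<forall>\<^sub>F x in nhds t. euler_lagrange x \<noteq> euler_lagrange t1"
      using EL nz by (simp add: eventually_nhds_conv_at)
    then show ?thesis
      by eventually_elim (use W_EL t1W in force)
  qed
  define W' where "W' = {t. \<forall>\<^sub>F x in nhds t. x \<notin> W}"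
  have "open W'" unfolding W'_def by (rule open_eventually_nhds)
  moreover have "W \<inter> W' \<inter> I = {}" using eventually_nhds_x_imp_x by (fastforce simp: W'_def)
  moreover have "I \<subseteq> W \<union> W'" using closed by (auto simp: W'_def)
  moreover have "connected I" using interval_I by (simp add: is_interval_connected_1)
  ultimately have "W \<inter> I = {} \<or> W' \<inter> I = {}" using open_W by (intro connectedD) auto
  then have "I \<subseteq> W" using t1W t1 \<open>I \<subseteq> W \<union> W'\<close> by blast
  then show False using nonconst W_s unfolding constant_on_def by blast
qed

section \<open>Integrability of 1/s and isolation of the zeros of \<open>s\<close>\<close>

lemma set_integrable_inverse_s:
  assumes "x \<in> I" "y \<in> I"
  shows "set_integrable lborel {x..y} (\<lambda>u. 1 / s u)"
  unfolding set_integrable_def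
proof (rule integrableI_bounded)
  have sub: "{x..y} \<subseteq> I" using mem_is_interval_1_I[OF interval_I assms] by auto
  have "(\<lambda>u. indicator {x..y} u *\<^sub>R s u) \<in> borel_measurable borel"
    using continuous_on_subset[OF s_cont sub] by (intro borel_measurable_continuous_on_indicator) auto
  \<comment> \<open>Because \<open>inverse 0 = 0\<close>, the cutoff to the interval survives
    inversion.\<close>
  then have "(\<lambda>u. inverse (indicator {x..y} u *\<^sub>R s u)) \<in> borel_measurable borel" by measurable
  moreover have "(\<lambda>u. inverse (indicator {x..y} u *\<^sub>R s u)) = (\<lambda>u. indicator {x..y} u *\<^sub>R (1 / s u))"
    by (auto simp: indicator_def fun_eq_iff inverse_eq_divide)
  ultimately show "(\<lambda>u. indicator {x..y} u *\<^sub>R (1 / s u)) \<in> borel_measurable lborel" by simp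
  \<comment> \<open>At a zero of \<open>s\<close> the real quotient is 0 and the
    \<open>ennreal\<close> inverse is infinite, so only an inequality holds; it has the right
    direction.\<close>
  have "ennreal (norm (indicator {x..y} u *\<^sub>R (1 / s u))) \<le> inverse (ennreal (s u)) * indicator {x..y} u" for u
  proof (cases "u \<in> {x..y}")
    case True
    then have "0 \<le> s u" using sub s_nonneg by auto
    then show ?thesis
      using True by (cases "s u = 0") (auto simp: inverse_ennreal inverse_eq_divide)
  qed simp
  then have "(\<integral>\<^sup>+ u. ennreal (norm (indicator {x..y} u *\<^sub>R (1 / s u))) \<partial>lborel)
      \<le> (\<integral>\<^sup>+u\<in>{x..y}. inverse (ennreal (s u)) \<partial>lborel)"
    by (intro nn_integral_mono)
  also have "\<dots> < \<infinity>" using inverse_s_finite assms by blast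
  finally show "(\<integral>\<^sup>+ u. ennreal (norm (indicator {x..y} u *\<^sub>R (1 / s u))) \<partial>lborel) < \<infinity>" .
qed

lemma interval_integrable_inverse_s:
  assumes "x \<in> I" "y \<in> I"
  shows "interval_lebesgue_integrable lborel (ereal x) (ereal y) (\<lambda>u. 1 / s u)"
proof (cases "x \<le> y")
  case True
  then show ?thesis
    unfolding interval_lebesgue_integrable_def
    by (auto intro: set_integrable_subset[OF set_integrable_inverse_s[OF assms]])
next
  case False
  then show ?thesis
    unfolding interval_lebesgue_integrable_def
    by (auto intro: set_integrable_subset[OF set_integrable_inverse_s[OF assms(2,1)]])
qed

lemma conformal_time_diff:
  assumes "x \<in> I" "y \<in> I"
  shows "conformal_time s t0 y - conformal_time s t0 x = (LBINT u=ereal x..ereal y. 1 / s u)"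
proof -
  have "min t0 (min x y) \<in> I" "max t0 (max x y) \<in> I" using assms t0_I by (auto simp: min_def max_def)
  then have "interval_lebesgue_integrable lborel (min (ereal t0) (min (ereal x) (ereal y)))
      (max (ereal t0) (max (ereal x) (ereal y))) (\<lambda>u. 1 / s u)"
    using interval_integrable_inverse_s by (simp add: ereal_min[symmetric] ereal_max[symmetric] del: ereal_min ereal_max)
  from interval_integral_sum[OF this] show ?thesis by (simp add: conformal_time_def)
qed

text \<open>If \<open>s\<close> vanished between x and y, the integral of 1/s would be 0 by the
  convention for division by 0, and conformal time would not increase strictly.\<close>

lemma exists_positive_between:
  assumes "x \<in> I" "y \<in> I" "x < y"
  shows "\<exists>z. x < z \<and> z < y \<and> 0 < s z"
proof (rule ccontr)
  assume neg: "\<not> ?thesis"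
  have "s z = 0" if "x < z" "z < y" for z
    using neg that s_nonneg[of z] mem_is_interval_1_I[OF interval_I assms(1,2), of z] by force
  then have "(LBINT u=ereal x..ereal y. 1 / s u) = (LBINT u=ereal x..ereal y. 0)"
    using assms(3) by (intro interval_integral_cong) (auto simp: einterval_iff)
  then have "conformal_time s t0 y = conformal_time s t0 x"
    using conformal_time_diff[OF assms(1,2)] by simp
  then show False using strict_mono_onD[OF time_strict_mono assms] by simp
qed

lemma kinetic_eq:
  assumes "t \<in> I" "0 < s t"
  shows "s t * (deriv s t)\<^sup>2 = H + s t - \<aa> / 3 * s t ^ 3"
  using first_integral[OF assms] by (simp add: algebra_simps eval_nat_numeral)

text \<open>In \<open>kinetic_eq\<close> the left side is nonnegative, while the right side tends to
  H at a zero. Positive values of \<open>s\<close> arbitrarily close to the zero exclude H <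
  0.\<close>

lemma H_pos_if_zero:
  assumes t: "t \<in> I" "s t = 0"
  shows "0 < H"
proof (rule ccontr)
  assume "\<not> 0 < H"
  then have "H < 0" using H by simp
  have "((\<lambda>x. H + s x - \<aa> / 3 * s x ^ 3) \<longlongrightarrow> H + s t - \<aa> / 3 * s t ^ 3) (at t)"
    using isCont_s[OF t(1)] unfolding isCont_def by (intro tendsto_intros)
  then have "\<forall>\<^sub>F x in at t. H + s x - \<aa> / 3 * s x ^ 3 < 0"
    using t \<open>H < 0\<close> by (intro order_tendstoD) auto
  moreover have "\<forall>\<^sub>F x in at t. x \<in> I" using t open_I by (intro eventually_at_in_open') auto
  ultimately have "\<forall>\<^sub>F x in at t. x \<in> I \<and> H + s x - \<aa> / 3 * s x ^ 3 < 0" by eventually_elim simp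
  then obtain d where d: "0 < d"
    "\<And>x. x \<noteq> t \<Longrightarrow> dist x t < d \<Longrightarrow> x \<in> I \<and> H + s x - \<aa> / 3 * s x ^ 3 < 0"
    by (auto simp: eventually_at)
  obtain z where z: "t < z" "z < t + d / 2" "0 < s z"
    using exists_positive_between[of t "t + d / 2"] t d by (auto simp: dist_real_def)
  then have "z \<in> I" "H + s z - \<aa> / 3 * s z ^ 3 < 0" using d(2)[of z] d(1) by (auto simp: dist_real_def)
  moreover have "0 \<le> s z * (deriv s z)\<^sup>2" using z by simp
  ultimately show False using kinetic_eq[of z] z by simp
qed

text \<open>Between two zeros close to each other, \<open>s\<close> would have a positive maximum with value close to
  \<open>0\<close>, but at such values the first integral forces \<open>s' \<noteq> 0\<close>.\<close>

lemma zero_isolated: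
  assumes t: "t \<in> I" "s t = 0"
  shows "\<forall>\<^sub>F x in at t. x \<in> I \<and> 0 < s x"
proof -
  have "((\<lambda>x. H + s x - \<aa> / 3 * s x ^ 3) \<longlongrightarrow> H + s t - \<aa> / 3 * s t ^ 3) (at t)"
    using isCont_s[OF t(1)] unfolding isCont_def by (intro tendsto_intros)
  then have "\<forall>\<^sub>F x in at t. 0 < H + s x - \<aa> / 3 * s x ^ 3"
    using t H_pos_if_zero[OF t] by (intro order_tendstoD) auto
  moreover have "\<forall>\<^sub>F x in at t. x \<in> I" using t open_I by (intro eventually_at_in_open') auto
  ultimately have "\<forall>\<^sub>F x in at t. x \<in> I \<and> 0 < H + s x - \<aa> / 3 * s x ^ 3" by eventually_elim simp
  then obtain d where d: "0 < d"
    "\<And>x. x \<noteq> t \<Longrightarrow> dist x t < d \<Longrightarrow> x \<in> I \<and> 0 < H + s x - \<aa> / 3 * s x ^ 3"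
    by (auto simp: eventually_at)
  have "0 < s x" if x: "x \<noteq> t" "dist x t < d" for x
  proof (rule ccontr)
    assume "\<not> 0 < s x"
    then have "s x = 0" using s_nonneg[of x] d(2)[OF x] by force
    define p q where "p = min x t" and "q = max x t"
    have pq: "p < q" "s p = 0" "s q = 0" "p \<in> I" "q \<in> I"
      using x t \<open>s x = 0\<close> d(2)[OF x] by (auto simp: p_def q_def min_def max_def)
    have sub: "{p..q} \<subseteq> I" using mem_is_interval_1_I[OF interval_I pq(4,5)] by auto
    obtain z where z: "p < z" "z < q" "0 < s z" using exists_positive_between[OF pq(4,5,1)] by blast
    obtain m where m: "m \<in> {p..q}" "\<And>y. y \<in> {p..q} \<Longrightarrow> s y \<le> s m"
      using continuous_attains_sup[of "{p..q}" s] continuous_on_subset[OF s_cont sub] pq(1) by auto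
    have "0 < s m" using m(2)[of z] z by simp
    then have mpq: "p < m" "m < q" using m(1) pq by (auto simp: order_less_le)
    have mI: "m \<in> I" using m(1) sub by blast
    have "deriv s m = 0"
    proof (rule DERIV_local_max[OF deriv_s[OF mI \<open>0 < s m\<close>]])
      show "0 < min (m - p) (q - m)" using mpq by simp
      show "\<forall>y. \<bar>m - y\<bar> < min (m - p) (q - m) \<longrightarrow> s y \<le> s m"
        using m(2) by (auto simp: abs_less_iff)
    qed
    moreover have "0 < H + s m - \<aa> / 3 * s m ^ 3"
      using d(2)[of m] mpq x \<open>0 < s m\<close> t by (auto simp: p_def q_def dist_real_def min_def max_def split: if_splits)
    ultimately show False using kinetic_eq[OF mI \<open>0 < s m\<close>] by simp
  qed
  then show ?thesis using d unfolding eventually_at by blast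
qed

end

section \<open>The universe in conformal time\<close>

context critical_universe
begin

section \<open>Energy density and pressure as functions of \<open>s\<close>, with their limits at
  zeros\<close>

lemma energy_density_eq:
  assumes "t \<in> I" "0 < s t"
  shows "energy_density \<Lambda> s t = 1 / (8 * pi) * (3 * H / s t ^ 3 + 6 / (s t)\<^sup>2 - \<aa> - \<Lambda>)"
proof -
  have kinetic: "(deriv s t)\<^sup>2 = H / s t + 1 - \<aa> / 3 * (s t)\<^sup>2"
    using kinetic_eq[OF assms] assms by (simp add: field_simps eval_nat_numeral)
  show ?thesis
    unfolding energy_density_def kinetic
    using assms by (simp add: field_simps eval_nat_numeral)
qed

lemma pressure_eq:
  assumes "t \<in> I" "0 < s t"
  shows "pressure \<Lambda> s t = 1 / (4 * pi) * ((\<aa> + \<Lambda>) / 2 - 1 / (s t)\<^sup>2)"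
proof -
  have accel: "deriv (deriv s) t = (1 - (deriv s t)\<^sup>2 - \<aa> * (s t)\<^sup>2) / (2 * s t)"
    using euler_lagrange_eq_0[OF assms] assms by (simp add: euler_lagrange_def field_simps)
  show ?thesis
    unfolding pressure_def accel using assms by (simp add: field_simps eval_nat_numeral)
qed

text \<open>Since zeros are isolated, the filter in \<open>Lim\<close> is nontrivial and the limit
  is unique.\<close>

lemma extend_to_zeros_eqI:
  assumes t: "t \<in> I" "s t = 0"
    and lim: "((\<lambda>u. ereal (f u)) \<longlongrightarrow> l) (at t within {u \<in> I. 0 < s u})"
  shows "extend_to_zeros I s f t = l"
proof -
  have "at t within {u \<in> I. 0 < s u} \<noteq> bot"
  proof
    assume "at t within {u \<in> I. 0 < s u} = bot"
    then have "\<forall>\<^sub>F u in at t within {u \<in> I. 0 < s u}. False" by simp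
    then have "\<forall>\<^sub>F u in at t. \<not> (u \<in> I \<and> 0 < s u)" by (simp add: eventually_at_filter)
    with zero_isolated[OF t] have "\<forall>\<^sub>F u in at t. False" by eventually_elim simp
    then show False by simp
  qed
  from tendsto_Lim[OF this lim] show ?thesis using t by (simp add: extend_to_zeros_def)
qed

lemma filterlim_inverse_s_power:
  assumes t: "t \<in> I" "s t = 0" and "0 < n"
  shows "filterlim (\<lambda>u. inverse (s u) ^ n) at_top (at t within {u \<in> I. 0 < s u})"
proof -
  have "(s \<longlongrightarrow> 0) (at t within {u \<in> I. 0 < s u})"
    using isCont_s[OF t(1)] t(2) by (metis continuous_at_imp_continuous_at_within continuous_within)
  moreover have "\<forall>\<^sub>F u in at t within {u \<in> I. 0 < s u}. 0 < s u"
    by (simp add: eventually_at_filter)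
  ultimately have "filterlim (\<lambda>u. inverse (s u)) at_top (at t within {u \<in> I. 0 < s u})"
    by (rule filterlim_inverse_at_top)
  then show ?thesis using assms(3) by (rule filterlim_pow_at_top[rotated])
qed

text \<open>A zero forces H > 0, so the terms in 1/s^3 and 1/s^2 both tend to plus infinity and
  cannot cancel.\<close>

lemma energy_density_at_zero:
  assumes t: "t \<in> I" "s t = 0"
  shows "extend_to_zeros I s (energy_density \<Lambda> s) t = \<infinity>"
proof (rule extend_to_zeros_eqI[OF t])
  let ?F = "at t within {u \<in> I. 0 < s u}"
  have "filterlim (\<lambda>u. 3 * H / (8 * pi) * inverse (s u) ^ 3
      + (- (\<aa> + \<Lambda>) / (8 * pi) + 6 / (8 * pi) * inverse (s u) ^ 2)) at_top ?F"
    using H_pos_if_zero[OF t] filterlim_inverse_s_power[OF t]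
    by (intro filterlim_at_top_add_at_top filterlim_tendsto_add_at_top[OF tendsto_const]
        filterlim_tendsto_pos_mult_at_top[OF tendsto_const]) auto
  moreover have "\<forall>\<^sub>F u in ?F. 3 * H / (8 * pi) * inverse (s u) ^ 3
      + (- (\<aa> + \<Lambda>) / (8 * pi) + 6 / (8 * pi) * inverse (s u) ^ 2) = energy_density \<Lambda> s u"
    unfolding eventually_at_filter
    by (intro always_eventually allI impI) (auto simp: energy_density_eq field_simps)
  ultimately have "filterlim (energy_density \<Lambda> s) at_top ?F"
    by (rule filterlim_cong[OF refl refl, THEN iffD1, rotated])
  then show "((\<lambda>u. ereal (energy_density \<Lambda> s u)) \<longlongrightarrow> \<infinity>) ?F"
    by (simp add: tendsto_PInfty_eq_at_top)
qed

lemma pressure_at_zero: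
  assumes t: "t \<in> I" "s t = 0"
  shows "extend_to_zeros I s (pressure \<Lambda> s) t = -\<infinity>"
proof (rule extend_to_zeros_eqI[OF t])
  let ?F = "at t within {u \<in> I. 0 < s u}"
  have "filterlim (\<lambda>u. - (\<aa> + \<Lambda>) / (8 * pi) + 1 / (4 * pi) * inverse (s u) ^ 2) at_top ?F"
    using filterlim_inverse_s_power[OF t]
    by (intro filterlim_tendsto_add_at_top[OF tendsto_const]
        filterlim_tendsto_pos_mult_at_top[OF tendsto_const]) auto
  moreover have "\<forall>\<^sub>F u in ?F. - (\<aa> + \<Lambda>) / (8 * pi) + 1 / (4 * pi) * inverse (s u) ^ 2 = - pressure \<Lambda> s u"
    unfolding eventually_at_filter
    by (intro always_eventually allI impI) (auto simp: pressure_eq field_simps)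
  ultimately have "filterlim (\<lambda>u. - pressure \<Lambda> s u) at_top ?F"
    by (rule filterlim_cong[OF refl refl, THEN iffD1, rotated])
  then have "((\<lambda>u. ereal (- pressure \<Lambda> s u)) \<longlongrightarrow> \<infinity>) ?F"
    by (simp add: tendsto_PInfty_eq_at_top)
  from tendsto_uminus_ereal[OF this] show "((\<lambda>u. ereal (pressure \<Lambda> s u)) \<longlongrightarrow> -\<infinity>) ?F"
    by simp
qed

section \<open>Conformal time and its inverse\<close>

lemma has_real_derivative_conformal_time:
  assumes t: "t \<in> I" "0 < s t"
  shows "(conformal_time s t0 has_real_derivative 1 / s t) (at t)"
proof -
  obtain d where d: "0 < d" "cball t d \<subseteq> {t \<in> I. 0 < s t}"
    using open_positive t by (metis (mono_tags, lifting) mem_Collect_eq open_contains_cball)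
  \<comment> \<open>The integral is rebased from \<open>t0\<close> to a nearby point c: zeros of
    \<open>s\<close> may lie between \<open>t0\<close> and t, but 1/s is continuous on
    \<open>{c..e}\<close>.\<close>
  define c e where "c = t - d" and "e = t + d"
  have sub: "{c..e} \<subseteq> {t \<in> I. 0 < s t}" using d by (simp add: c_def e_def cball_eq_atLeastAtMost)
  have te: "c < t" "t < e" using d by (auto simp: c_def e_def)
  have "continuous_on {c..e} (\<lambda>u. 1 / s u)"
    using sub by (intro continuous_intros continuous_on_subset[OF s_cont]) auto
  from integral_has_real_derivative[OF this, of t]
  have "((\<lambda>x. integral {c..x} (\<lambda>u. 1 / s u)) has_real_derivative 1 / s t) (at t)"
    using te by (simp add: at_within_Icc_at)
  then have "((\<lambda>x. conformal_time s t0 c + integral {c..x} (\<lambda>u. 1 / s u)) has_real_derivative 1 / s t) (at t)"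
    by (auto intro!: derivative_eq_intros)
  then show ?thesis
  proof (rule has_field_derivative_transform_within_open[of _ _ _ "{c<..<e}"])
    fix x assume "x \<in> {c<..<e}"
    then have "c \<le> x" "c \<in> {c..e}" "x \<in> {c..e}" by auto
    then have x: "c \<le> x" "c \<in> I" "x \<in> I" using sub by blast+
    show "conformal_time s t0 c + integral {c..x} (\<lambda>u. 1 / s u) = conformal_time s t0 x"
      using conformal_time_diff[OF x(2,3)] interval_integral_eq_integral[OF x(1) set_integrable_inverse_s[OF x(2,3)]]
      by simp
  qed (use te in auto)
qed

definition time_at :: "real \<Rightarrow> real" where
  "time_at = inv_into I (conformal_time s t0)"

abbreviation J :: "real set" where
  "J \<equiv> conformal_interval I s t0"

lemma time_inj: "inj_on (conformal_time s t0) I"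
  using time_strict_mono by (rule strict_mono_on_imp_inj_on)

lemma time_at_in: "\<tau> \<in> J \<Longrightarrow> time_at \<tau> \<in> I"
  unfolding time_at_def conformal_interval_def by (rule inv_into_into)

lemma conformal_time_time_at: "\<tau> \<in> J \<Longrightarrow> conformal_time s t0 (time_at \<tau>) = \<tau>"
  unfolding time_at_def conformal_interval_def by (rule f_inv_into_f)

lemma time_at_conformal_time: "t \<in> I \<Longrightarrow> time_at (conformal_time s t0 t) = t"
  unfolding time_at_def using time_inj by simp

lemma open_J: "open J"
  unfolding conformal_interval_def
  using injective_into_1d_imp_open_map_UNIV[OF open_I time_cont time_inj subset_refl] .

lemma interval_J: "is_interval J"
  unfolding conformal_interval_def is_interval_connected_1
  using time_cont interval_I by (intro connected_continuous_image) (auto simp: is_interval_connected_1)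

lemma isCont_time_at: "\<tau> \<in> J \<Longrightarrow> isCont time_at \<tau>"
  using differentiable_imp_continuous_on[OF time_inverse_differentiable] continuous_on_eq_continuous_at[OF open_J]
  unfolding time_at_def[abs_def, symmetric] conformal_interval_def[symmetric] by blast

lemma has_real_derivative_time_at:
  assumes \<tau>: "\<tau> \<in> J" "0 < s (time_at \<tau>)"
  shows "(time_at has_real_derivative s (time_at \<tau>)) (at \<tau>)"
proof -
  obtain d where d: "0 < d" "ball \<tau> d \<subseteq> J" using open_J \<tau> openE by blast
  have "(time_at has_real_derivative inverse (1 / s (time_at \<tau>))) (at \<tau>)"
  proof (rule DERIV_inverse_function)
    show "(conformal_time s t0 has_real_derivative 1 / s (time_at \<tau>)) (at (time_at \<tau>))"
      using \<tau> time_at_in by (intro has_real_derivative_conformal_time) auto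
    show "\<tau> - d < \<tau>" "\<tau> < \<tau> + d" using d by auto
    show "conformal_time s t0 (time_at x) = x" if "\<tau> - d < x" "x < \<tau> + d" for x
      using that d by (intro conformal_time_time_at) (auto simp: dist_real_def subset_iff)
  qed (use \<tau> isCont_time_at in auto)
  then show ?thesis by simp
qed

section \<open>The universe as a trajectory\<close>

definition g :: real where "g = \<aa> * H\<^sup>2 / 48"
definition b :: real where "b = 2 + \<bar>g\<bar>"

text \<open>\<open>u = 1 / (Q - 1/12 + b)\<close> for \<open>Q = 1/12 + H / (4 s)\<close>\<close>

definition u :: "real \<Rightarrow> real" where
  "u t = 4 * s t / (H + 4 * b * s t)"

text \<open>This is s du/dt, the derivative in conformal time. The factor \<open>s t\<close> makes
  it 0 at a zero of \<open>s\<close>, whatever value \<open>deriv s\<close> has there.\<close>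

definition u' :: "real \<Rightarrow> real" where
  "u' t = 4 * H * (s t * deriv s t) / (H + 4 * b * s t)\<^sup>2"

text \<open>The issue is H < 0. The cubic at w = H / (4 s) is the square of a conformal velocity, so
  w cannot lie in the range of \<open>cubic_neg\<close>, and the denominator is 4 s (w + b).\<close>

lemma denominator_pos:
  assumes t: "t \<in> I"
  shows "0 < H + 4 * b * s t"
proof (cases "s t = 0")
  case True
  then show ?thesis using H_pos_if_zero[OF t] by simp
next
  case False
  then have st: "0 < s t" using s_nonneg[OF t] by simp
  define w where "w = H / (4 * s t)"
  have "4 * w ^ 3 + w\<^sup>2 - g = (H * deriv s t / (4 * s t))\<^sup>2"
  proof -
    have kinetic: "(deriv s t)\<^sup>2 = H / s t + 1 - \<aa> / 3 * (s t)\<^sup>2"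
      using kinetic_eq[OF t st] st by (simp add: field_simps eval_nat_numeral)
    show ?thesis
      unfolding w_def g_def power_divide power_mult_distrib kinetic using st by (simp add: field_simps eval_nat_numeral)
  qed
  then have "\<not> 4 * w ^ 3 + w\<^sup>2 - g < 0" by simp
  then have "- 1 - \<bar>g\<bar> < w" using cubic_neg[of w g] by linarith
  then have "0 < w + b" by (simp add: b_def)
  then have "0 < 4 * s t * (w + b)" using st by simp
  also have "\<dots> = H + 4 * b * s t" using st by (simp add: w_def field_simps)
  finally show ?thesis .
qed

lemma u'_square:
  assumes t: "t \<in> I"
  shows "(u' t)\<^sup>2 = quartic b g (u t)"
proof (cases "s t = 0")
  case True
  then show ?thesis by (simp add: u'_def u_def quartic_def)
next
  case False
  then have st: "0 < s t" using s_nonneg[OF t] by simp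
  let ?D = "H + 4 * b * s t"
  have D: "?D \<noteq> 0" using denominator_pos[OF t] by simp
  have 1: "u t * ?D = 4 * s t" "(1 - b * u t) * ?D = H"
    using D by (simp_all add: u_def field_simps)
  have "(s t * deriv s t)\<^sup>2 = s t * (s t * (deriv s t)\<^sup>2)" by (simp add: power2_eq_square)
  also have "\<dots> = s t * (H + s t - \<aa> / 3 * s t ^ 3)" by (simp only: kinetic_eq[OF t st])
  finally have 2: "(s t * deriv s t)\<^sup>2 = s t * (H + s t - \<aa> / 3 * s t ^ 3)" .
  have "(u' t)\<^sup>2 * ?D ^ 4 = 16 * H\<^sup>2 * (s t * deriv s t)\<^sup>2"
    unfolding u'_def using D by (simp add: power_divide power_mult_distrib flip: power_mult)
  also have "\<dots> = (4 * s t * H ^ 3 * 4 + 16 * (s t)\<^sup>2 * H\<^sup>2 - g * (4 * s t) ^ 4)"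
    unfolding 2 g_def by (simp add: algebra_simps eval_nat_numeral)
  also have "\<dots> = 4 * (u t * ?D) * ((1 - b * u t) * ?D) ^ 3
      + (u t * ?D)\<^sup>2 * ((1 - b * u t) * ?D)\<^sup>2 - g * (u t * ?D) ^ 4"
    unfolding 1 by (simp add: power_mult_distrib)
  also have "\<dots> = quartic b g (u t) * ?D ^ 4"
    by (rule quartic_scale[symmetric])
  finally show ?thesis using D by simp
qed

lemma has_real_derivative_u:
  assumes t: "t \<in> I" "0 < s t"
  shows "(u has_real_derivative u' t / s t) (at t)"
proof -
  have D: "H + 4 * b * s t \<noteq> 0" using denominator_pos[OF t(1)] by simp
  have "(u has_real_derivative 4 * H * deriv s t / (H + 4 * b * s t)\<^sup>2) (at t)"
    unfolding u_def
    by (rule derivative_eq_intros deriv_s t refl D)+ (simp add: power2_eq_square algebra_simps)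
  then show ?thesis using t by (simp add: u'_def mult.assoc)
qed

lemma has_real_derivative_u':
  assumes t: "t \<in> I" "0 < s t"
  shows "(u' has_real_derivative half_quartic_deriv b g (u t) / s t) (at t)"
proof -
  \<comment> \<open>The first integral eliminates \<open>?k\<close>; the second-order equation
    eliminates \<open>?a\<close>, the derivative of \<open>s * deriv s\<close>. What remains is
    polynomial in \<open>s\<close>.\<close>
  let ?k = "s t * (deriv s t)\<^sup>2" and ?a = "s t * deriv (deriv s) t + (deriv s t)\<^sup>2"
  define D where "D = H + 4 * b * s t"
  have D: "D \<noteq> 0" using denominator_pos[OF t(1)] by (simp add: D_def)
  have uD: "u t * D = 4 * s t" using D by (simp add: u_def D_def)
  have k: "?k = H + s t - \<aa> / 3 * s t ^ 3" by (rule kinetic_eq[OF t])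
  have a: "2 * ?a = (deriv s t)\<^sup>2 + 1 - \<aa> * (s t)\<^sup>2"
    using euler_lagrange_eq_0[OF t] by (simp add: euler_lagrange_def algebra_simps)
  define E where "E = (4 * H * ?a * D\<^sup>2 - 4 * H * (s t * deriv s t) * (8 * b * D * deriv s t)) / (D\<^sup>2 * D\<^sup>2)"
  have "((\<lambda>t. 4 * H * (s t * deriv s t)) has_real_derivative 4 * H * ?a) (at t)"
    by (rule derivative_eq_intros deriv_s deriv2_s t refl)+ (simp add: algebra_simps power2_eq_square)
  moreover have "((\<lambda>t. (H + 4 * b * s t)\<^sup>2) has_real_derivative 8 * b * D * deriv s t) (at t)"
    by (rule derivative_eq_intros deriv_s t refl)+ (simp add: D_def algebra_simps)
  ultimately have "(u' has_real_derivative E) (at t)"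
    unfolding u'_def E_def D_def using D D_def by (intro DERIV_divide) auto
  moreover have "E * s t * D ^ 3 = half_quartic_deriv b g (u t) * D ^ 3"
  proof -
    have "E * s t * D ^ 3 = 2 * H * D * (s t * (2 * ?a)) - 32 * H * b * s t * ?k"
      unfolding E_def using D by (simp add: field_simps eval_nat_numeral)
    also have "\<dots> = 2 * H * D * (?k + s t - \<aa> * s t ^ 3) - 32 * H * b * s t * ?k"
      unfolding a by (simp add: algebra_simps eval_nat_numeral)
    also have "\<dots> = 2 * D ^ 3 + (1 - 12 * b) * (4 * s t) * D\<^sup>2
        + (18 * b\<^sup>2 - 3 * b) * (4 * s t)\<^sup>2 * D + 2 * (b\<^sup>2 - 4 * b ^ 3 - g) * (4 * s t) ^ 3"
      unfolding k g_def D_def by (simp add: algebra_simps eval_nat_numeral)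
    also have "\<dots> = half_quartic_deriv b g (u t) * D ^ 3"
      unfolding uD[symmetric] by (rule half_quartic_deriv_scale[symmetric])
    finally show ?thesis .
  qed
  then have "E * s t = half_quartic_deriv b g (u t)" using D by simp
  then have "E = half_quartic_deriv b g (u t) / s t" using t by (simp add: field_simps)
  ultimately show ?thesis by simp
qed

lemma trajectory_u:
  "trajectory b g (\<lambda>\<tau>. u (time_at \<tau>)) (\<lambda>\<tau>. u' (time_at \<tau>)) J"
proof -
  let ?y = "\<lambda>\<tau>. u (time_at \<tau>)" and ?v = "\<lambda>\<tau>. u' (time_at \<tau>)"
  have sq: "(?v \<tau>)\<^sup>2 = quartic b g (?y \<tau>)" if "\<tau> \<in> J" for \<tau>
    using u'_square time_at_in[OF that] by blast
  have regular: "(?y has_real_derivative ?v \<tau>) (at \<tau>) \<and>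
      (?v has_real_derivative half_quartic_deriv b g (?y \<tau>)) (at \<tau>)"
    if \<tau>: "\<tau> \<in> J" "0 < s (time_at \<tau>)" for \<tau>
    using DERIV_chain2[OF has_real_derivative_u has_real_derivative_time_at[OF \<tau>]]
      DERIV_chain2[OF has_real_derivative_u' has_real_derivative_time_at[OF \<tau>]]
      time_at_in[OF \<tau>(1)] \<tau>(2) by simp
  have singular: "(?y has_real_derivative ?v \<tau>) (at \<tau>) \<and>
      (?v has_real_derivative half_quartic_deriv b g (?y \<tau>)) (at \<tau>)"
    if \<tau>: "\<tau> \<in> J" "s (time_at \<tau>) = 0" for \<tau>
  proof -
    note tI = time_at_in[OF \<tau>(1)]
    have "isCont u (time_at \<tau>)"
      unfolding u_def using denominator_pos[OF tI] isCont_s[OF tI] by (intro continuous_intros) auto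
    then have y_cont: "isCont ?y \<tau>"
      using isCont_time_at[OF \<tau>(1)] isCont_o2[of \<tau> time_at u] by simp
    have evJ: "\<forall>\<^sub>F x in at \<tau>. x \<in> J" using open_J \<tau>(1) by (intro eventually_at_in_open') auto
    \<comment> \<open>Injectivity of \<open>time_at\<close> transfers the isolation of zeros from t
      to conformal time.\<close>
    have "\<forall>\<^sub>F x in at \<tau>. time_at x \<noteq> time_at \<tau>"
      using evJ eventually_neq_at_within[of \<tau> \<tau> UNIV]
      by eventually_elim (metis \<tau>(1) conformal_time_time_at)
    then have "filterlim time_at (at (time_at \<tau>)) (at \<tau>)"
      using isCont_time_at[OF \<tau>(1)] by (simp add: filterlim_at isCont_def)
    then have "\<forall>\<^sub>F x in at \<tau>. time_at x \<in> I \<and> 0 < s (time_at x)"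
      using zero_isolated[OF tI \<tau>(2)] by (auto simp: filterlim_iff)
    with evJ have ev: "\<forall>\<^sub>F x in at \<tau>. (?y has_real_derivative ?v x) (at x) \<and>
        (?v has_real_derivative half_quartic_deriv b g (?y x)) (at x)"
      by eventually_elim (use regular in auto)
    have y0: "?y \<tau> = 0" "?v \<tau> = 0" using \<tau>(2) by (simp_all add: u_def u'_def)
    have y_lim: "(?y \<longlongrightarrow> 0) (at \<tau>)" using y_cont y0(1) by (simp add: isCont_def)
    \<comment> \<open>No bound on \<open>deriv s\<close> near the zero is at hand, but the
      constraint gives |v| = sqrt (R(y)), which tends to sqrt (R(0)) = 0.\<close>
    have "((\<lambda>x. sqrt (quartic b g (?y x))) \<longlongrightarrow> sqrt (quartic b g 0)) (at \<tau>)"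
      unfolding quartic_def by (intro tendsto_intros y_lim)
    moreover have "\<forall>\<^sub>F x in at \<tau>. sqrt (quartic b g (?y x)) = \<bar>?v x\<bar>"
      using evJ by eventually_elim (metis sq real_sqrt_abs)
    ultimately have "((\<lambda>x. \<bar>?v x\<bar>) \<longlongrightarrow> 0) (at \<tau>)"
      using Lim_transform_eventually by (fastforce simp: quartic_def)
    then have v_lim: "(?v \<longlongrightarrow> 0) (at \<tau>)" by (rule tendsto_rabs_zero_cancel)
    have "(?y has_real_derivative 0) (at \<tau>)"
      using y_cont eventually_mono[OF ev] v_lim by (intro has_real_derivative_removable[of _ _ ?v]) auto
    moreover have "((\<lambda>x. half_quartic_deriv b g (?y x)) \<longlongrightarrow> half_quartic_deriv b g 0) (at \<tau>)"
      unfolding half_quartic_deriv_def by (intro tendsto_intros y_lim)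
    then have "(?v has_real_derivative half_quartic_deriv b g 0) (at \<tau>)"
      using v_lim y0 eventually_mono[OF ev]
      by (intro has_real_derivative_removable[of _ _ "\<lambda>x. half_quartic_deriv b g (?y x)"]) (auto simp: isCont_def)
    ultimately show ?thesis using y0 by simp
  qed
  have "0 < s (time_at \<tau>) \<or> s (time_at \<tau>) = 0" if "\<tau> \<in> J" for \<tau>
    using s_nonneg[OF time_at_in[OF that]] by linarith
  then show ?thesis unfolding trajectory_def using sq regular singular by blast
qed

lemma weierstrass_extension:
  obtains Q where "weierstrass_real_form (1 / 12) (g - 1 / 216) Q"
    "\<And>\<tau>. \<tau> \<in> J \<Longrightarrow> Q \<tau> = (if s (time_at \<tau>) = 0 then \<infinity> else ereal (H / (4 * s (time_at \<tau>)) + 1 / 12))"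
proof -
  define \<tau>0 where "\<tau>0 = conformal_time s t0 t0"
  have \<tau>0: "\<tau>0 \<in> J" using t0_I by (simp add: \<tau>0_def conformal_interval_def)
  \<comment> \<open>The global trajectory takes its data from the universe at \<open>t0\<close>;
    uniqueness then identifies the two on all of \<open>J\<close>.\<close>
  obtain y v where yv: "y \<tau>0 = u (time_at \<tau>0)" "v \<tau>0 = u' (time_at \<tau>0)" "trajectory b g y v UNIV"
    using trajectory_global[OF b_def u'_square[OF time_at_in[OF \<tau>0]]] by metis
  have y_eq: "y \<tau> = u (time_at \<tau>)" if "\<tau> \<in> J" for \<tau>
    by (rule trajectory_unique(1)[OF b_def trajectory_subset[OF yv(3)] trajectory_u interval_J \<tau>0 yv(1,2) that]) simp
  have Q_eq: "(if y \<tau> = 0 then \<infinity> else ereal (1 / y \<tau> - b + 1 / 12)) =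
      (if s (time_at \<tau>) = 0 then \<infinity> else ereal (H / (4 * s (time_at \<tau>)) + 1 / 12))" if "\<tau> \<in> J" for \<tau>
    using denominator_pos[OF time_at_in[OF that]] y_eq[OF that]
    by (auto simp: u_def field_simps)
  have "\<not> y constant_on UNIV"
  proof
    assume "y constant_on UNIV"
    then obtain c where c: "\<And>x. y x = c" by (auto simp: constant_on_def)
    \<comment> \<open>As H is nonzero, u is an injective function of s; this solves u = c for s, so
      a constant u would make \<open>s\<close> constant.\<close>
    have "s t = (if c = 0 then 0 else H / (4 * (1 / c - b)))" if t: "t \<in> I" for t
    proof -
      have "u t = c"
        using c y_eq[of "conformal_time s t0 t"] t by (simp add: conformal_interval_def time_at_conformal_time)
      then have "4 * s t = c * (H + 4 * b * s t)"
        using denominator_pos[OF t] by (simp add: u_def field_simps)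
      then have "4 * s t * (1 / c - b) = H" if "c \<noteq> 0"
      proof -
        have "4 * s t * (1 / c - b) = 4 * s t / c - 4 * b * s t" by (simp add: algebra_simps)
        also have "\<dots> = H" unfolding \<open>4 * s t = _\<close> using that by simp
        finally show ?thesis .
      qed
      moreover have "s t = H / (4 * w)" if "4 * s t * w = H" for w
        using H that by (cases "w = 0") (auto simp: field_simps)
      ultimately have "s t = H / (4 * (1 / c - b))" if "c \<noteq> 0" using that by blast
      then show ?thesis using \<open>4 * s t = _\<close> by (cases "c = 0") auto
    qed
    then show False using nonconst unfolding constant_on_def by blast
  qed
  from trajectory_imp_weierstrass_real_form[OF b_def yv(3) this] show ?thesis
    by (rule that) (rule Q_eq)
qed

end

theorem proposition2:
  fixes I :: "real set" and s :: "real \<Rightarrow> real" and t0 H \<aa> \<Lambda> :: real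
  assumes "closed_RW I s t0"
    and "m_critical \<Lambda> I s"
    and "\<not> s constant_on I"
    and "internal_parameters I s H \<aa>"
    and "H \<noteq> 0"
  shows "\<exists>Q. weierstrass_real_form (1 / 12) (1 / 48 * (\<aa> * H\<^sup>2 - 2 / 9)) Q \<and>
    (\<forall>\<tau>\<in>conformal_interval I s t0.
       ereal (conformal_scale I s t0 \<tau>) = ereal (3 * H) / (12 * Q \<tau> - 1) \<and>
       conformal_energy_density \<Lambda> I s t0 \<tau> =
         ereal (1 / (8 * pi)) *
           ((1 - 12 * Q \<tau>)\<^sup>2 * (5 + 12 * Q \<tau>) / ereal (9 * H\<^sup>2) - ereal \<aa> - ereal \<Lambda>) \<and>
       conformal_pressure \<Lambda> I s t0 \<tau> =
         ereal (1 / (4 * pi)) *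
           (ereal ((\<aa> + \<Lambda>) / 2) - (12 * Q \<tau> - 1)\<^sup>2 / ereal (9 * H\<^sup>2)))"
proof -
  interpret critical_universe I s t0 H \<aa> using assms by unfold_locales
  obtain Q where Q: "weierstrass_real_form (1 / 12) (g - 1 / 216) Q"
    "\<And>\<tau>. \<tau> \<in> J \<Longrightarrow> Q \<tau> = (if s (time_at \<tau>) = 0 then \<infinity> else ereal (H / (4 * s (time_at \<tau>)) + 1 / 12))"
    using weierstrass_extension by blast
  have "g - 1 / 216 = 1 / 48 * (\<aa> * H\<^sup>2 - 2 / 9)" by (simp add: g_def field_simps)
  then have "weierstrass_real_form (1 / 12) (1 / 48 * (\<aa> * H\<^sup>2 - 2 / 9)) Q" using Q(1) by (simp only:)
  moreover have "ereal (conformal_scale I s t0 \<tau>) = ereal (3 * H) / (12 * Q \<tau> - 1) \<and>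
       conformal_energy_density \<Lambda> I s t0 \<tau> =
         ereal (1 / (8 * pi)) *
           ((1 - 12 * Q \<tau>)\<^sup>2 * (5 + 12 * Q \<tau>) / ereal (9 * H\<^sup>2) - ereal \<aa> - ereal \<Lambda>) \<and>
       conformal_pressure \<Lambda> I s t0 \<tau> =
         ereal (1 / (4 * pi)) *
           (ereal ((\<aa> + \<Lambda>) / 2) - (12 * Q \<tau> - 1)\<^sup>2 / ereal (9 * H\<^sup>2))"
    if \<tau>: "\<tau> \<in> J" for \<tau>
  proof -
    define t where "t = time_at \<tau>"
    have t: "t \<in> I" using time_at_in[OF \<tau>] by (simp add: t_def)
    have S: "conformal_scale I s t0 \<tau> = s t"
      "conformal_energy_density \<Lambda> I s t0 \<tau> = extend_to_zeros I s (energy_density \<Lambda> s) t"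
      "conformal_pressure \<Lambda> I s t0 \<tau> = extend_to_zeros I s (pressure \<Lambda> s) t"
      by (simp_all add: conformal_scale_def conformal_energy_density_def conformal_pressure_def t_def time_at_def)
    show ?thesis
    proof (cases "s t = 0")
      case True
      then have "Q \<tau> = \<infinity>" using Q(2)[OF \<tau>] by (simp add: t_def)
      then show ?thesis
        \<comment> \<open>At a pole both sides are evaluated in \<open>ereal\<close>: 3 H divided by
          infinity is 0, and the two densities become plus and minus infinity.\<close>
        unfolding S energy_density_at_zero[OF t True] pressure_at_zero[OF t True]
        using H True by (simp add: numeral_eq_ereal one_ereal_def power2_eq_square)
    next
      case False
      then have st: "0 < s t" using s_nonneg[OF t] by simp
      \<comment> \<open>x is 12 Q - 1, in which all three formulas become rational
        identities.\<close>
      define x where "x = 3 * H / s t"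
      have x: "x \<noteq> 0" using H st by (simp add: x_def)
      have Q\<tau>: "Q \<tau> = ereal ((x + 1) / 12)"
        using Q(2)[OF \<tau>] False by (simp add: t_def x_def field_simps)
      have Q12: "12 * Q \<tau> - 1 = ereal x" "1 - 12 * Q \<tau> = ereal (- x)" "5 + 12 * Q \<tau> = ereal (x + 6)"
        unfolding Q\<tau> by (simp_all add: numeral_eq_ereal one_ereal_def add_divide_distrib)
      have e: "extend_to_zeros I s (energy_density \<Lambda> s) t = ereal (energy_density \<Lambda> s t)"
        "extend_to_zeros I s (pressure \<Lambda> s) t = ereal (pressure \<Lambda> s t)"
        using st by (simp_all add: extend_to_zeros_def)
      have "s t = 3 * H / x" using st H by (simp add: x_def)
      moreover have "energy_density \<Lambda> s t = 1 / (8 * pi) * (x * x * (x + 6) / (9 * H\<^sup>2) - \<aa> - \<Lambda>)"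
        unfolding energy_density_eq[OF t st] x_def using st H by (simp add: field_simps eval_nat_numeral)
      moreover have "pressure \<Lambda> s t = 1 / (4 * pi) * ((\<aa> + \<Lambda>) / 2 - x * x / (9 * H\<^sup>2))"
        unfolding pressure_eq[OF t st] x_def using st H by (simp add: field_simps eval_nat_numeral)
      ultimately show ?thesis
        unfolding S e Q12 using x H by (simp add: power2_eq_square)
    qed
  qed
  ultimately show ?thesis by blast
qed

end
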